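(* Let $\mathcal{G}$ be a transitive topological groupoid with proper target map, fix $b\in\mathcal{G}^0$, and let $X$ be a right $\mathcal{G}$-space. Then $X$ is a $\mathcal{G}$-CW-complex if and only if $X_b$ is a $\mathcal{G}_b^b$-CW-complex.
   Context: All spaces are Hausdorff and compactly generated, and maps are continuous. A topological groupoid $\mathcal{G}$ has an object space $\mathcal{G}^0$ and an arrow space $\mathcal{G}^1$, both Hausdorff, with continuous structure maps (identity $i\colon\mathcal{G}^0\to\mathcal{G}^1$, source $s$, target $t$, inverse, and composition $gh:=g\circ h$, defined when $s(g)=t(h)$), and $s$ (hence $t$) is open. It is transitive if its orbit space $\mathcal{G}^0/\mathcal{G}^1$ is a single point. Proper maps are those for which preimages of compact sets are compact. For $b\in\mathcal{G}^0$: $\mathcal{G}_b^b=\{g\mid s(g)=t(g)=b\}$ (a group) and $\mathcal{G}^b=t^{-1}(b)$. A right $\mathcal{G}$-space is a space $X$ with an anchor map $a_X\colon X\to\mathcal{G}^0$ and a continuous action $(x,g)\mapsto xg$ defined when $a_X(x)=t(g)$, such that $a_X(xg)=s(g)$, $x\,i(a_X(x))=x$, and $(xg)g'=x(gg')$ whenever defined. The fiber $X_b:=a_X^{-1}(b)$ is a right $\mathcal{G}_b^b$-space by restriction. For a subgroup $H\le\mathcal{G}_b^b$, $\mathcal{G}^b/H$ is the quotient of $\mathcal{G}^b$ by the left action of $H$ by composition; it is a right $\mathcal{G}$-space with anchor $[f]\mapsto s(f)$ and action $[f]g=[fg]$. A $\mathcal{G}$-CW-complex (with finite skeleta) is a right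 $\mathcal{G}$-space $X=\bigcup_n X^n$ (colimit topology), where $X^0$ is a finite disjoint union of $\mathcal{G}$-spaces $\mathcal{G}^b/H_i$ with $H_i\le\mathcal{G}_b^b$ closed, and $X^{n+1}$ is obtained from $X^n$ as the pushout of right $\mathcal{G}$-spaces along finitely many $\mathcal{G}$-equivariant attaching maps $\mathcal{G}^b/H_i\times S^n\to X^n$ and the inclusions $\mathcal{G}^b/H_i\times S^n\hookrightarrow\mathcal{G}^b/H_i\times D^{n+1}$ ($H_i\le\mathcal{G}_b^b$ closed, $\mathcal{G}$ acting on the first factor, anchor map factoring through the first projection). A $\mathcal{G}_b^b$-CW-complex is the same notion for the group $\mathcal{G}_b^b$ regarded as a groupoid with one object, i.e. with cells $\mathcal{G}_b^b/H_i\times D^n$ (quotient by left multiplication by $H_i$, right $\mathcal{G}_b^b$-action) and finitely many cells in each dimension. *)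

theory Defs
  imports "HOL-Analysis.Analysis" "HOL-Algebra.Group"
begin

(* Spaces are Hausdorff k-spaces in the sense of the library: a set is closed iff its intersection
   with every compact set is.  Products and fibre products are formed in this category, so they
   carry the kification of the usual topology. *)
definition cg_space :: "'p topology \<Rightarrow> bool" where
  "cg_space T \<longleftrightarrow> Hausdorff_space T \<and> k_space T"

definition cg_prod :: "'p topology \<Rightarrow> 'q topology \<Rightarrow> ('p \<times> 'q) topology" where
  "cg_prod S T = kification (prod_topology S T)"

definition cg_fibre_prod ::
  "'p topology \<Rightarrow> 'q topology \<Rightarrow> ('p \<Rightarrow> 'r) \<Rightarrow> ('q \<Rightarrow> 'r) \<Rightarrow> ('p \<times> 'q) topology" where
  "cg_fibre_prod S T f g = kification (subtopology (prod_topology S T) {(x, y). f x = g y})"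

(* The points of the quotient are the classes R `` {x}. *)
definition quotient_topology :: "'p topology \<Rightarrow> ('p \<times> 'p) set \<Rightarrow> 'p set topology" where
  "quotient_topology T R =
     topology (\<lambda>U. U \<subseteq> topspace T // R \<and> openin T {x \<in> topspace T. R `` {x} \<in> U})"

lemma openin_quotient_topology:
  "openin (quotient_topology T R) U \<longleftrightarrow>
     U \<subseteq> topspace T // R \<and> openin T {x \<in> topspace T. R `` {x} \<in> U}"
proof -
  have 1: "{x \<in> topspace T. R `` {x} \<in> U \<inter> V} =
      {x \<in> topspace T. R `` {x} \<in> U} \<inter> {x \<in> topspace T. R `` {x} \<in> V}" for U V
    by auto
  have 2: "{x \<in> topspace T. R `` {x} \<in> \<Union>K} = (\<Union>U\<in>K. {x \<in> topspace T. R `` {x} \<in> U})" for K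
    by auto
  have "istopology (\<lambda>U. U \<subseteq> topspace T // R \<and> openin T {x \<in> topspace T. R `` {x} \<in> U})"
    unfolding istopology_def 1 2 by blast
  then show ?thesis
    by (simp add: quotient_topology_def)
qed

definition binary_sum_topology :: "'p topology \<Rightarrow> 'q topology \<Rightarrow> ('p + 'q) topology" where
  "binary_sum_topology S T = topology (\<lambda>U. openin S (Inl -` U) \<and> openin T (Inr -` U))"

lemma openin_binary_sum_topology:
  "openin (binary_sum_topology S T) U \<longleftrightarrow> openin S (Inl -` U) \<and> openin T (Inr -` U)"
proof -
  have "istopology (\<lambda>U. openin S (Inl -` U) \<and> openin T (Inr -` U))"
    unfolding istopology_def by (auto simp: vimage_Union)
  then show ?thesis
    by (simp add: binary_sum_topology_def)
qed

(* The closed unit disc in R^n, in the library's model of R^n, so that nsphere n is the boundary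
   sphere of ndisc (Suc n). *)
definition ndisc :: "nat \<Rightarrow> (nat \<Rightarrow> real) topology" where
  "ndisc n = subtopology (Euclidean_space n) {x. (\<Sum>i<n. x i ^ 2) \<le> 1}"


record ('o, 'a) groupoid_data =
  obj :: "'o topology"
  arr :: "'a topology"
  idt :: "'o \<Rightarrow> 'a"
  src :: "'a \<Rightarrow> 'o"
  tgt :: "'a \<Rightarrow> 'o"
  ginv :: "'a \<Rightarrow> 'a"
  gcomp :: "'a \<Rightarrow> 'a \<Rightarrow> 'a"

(* gcomp G g h is "g after h", meaningful when src G g = tgt G h. *)
locale topological_groupoid =
  fixes G :: "('o, 'a) groupoid_data"
  assumes cg_obj: "cg_space (obj G)"
    and cg_arr: "cg_space (arr G)"
    and continuous_idt: "continuous_map (obj G) (arr G) (idt G)"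
    and continuous_src: "continuous_map (arr G) (obj G) (src G)"
    and continuous_tgt: "continuous_map (arr G) (obj G) (tgt G)"
    and continuous_ginv: "continuous_map (arr G) (arr G) (ginv G)"
    and continuous_gcomp:
      "continuous_map (cg_fibre_prod (arr G) (arr G) (src G) (tgt G)) (arr G) (\<lambda>(g, h). gcomp G g h)"
    and open_src: "open_map (arr G) (obj G) (src G)"
    and src_idt: "x \<in> topspace (obj G) \<Longrightarrow> src G (idt G x) = x"
    and tgt_idt: "x \<in> topspace (obj G) \<Longrightarrow> tgt G (idt G x) = x"
    and src_gcomp: "\<lbrakk>g \<in> topspace (arr G); h \<in> topspace (arr G); src G g = tgt G h\<rbrakk>
      \<Longrightarrow> src G (gcomp G g h) = src G h"
    and tgt_gcomp: "\<lbrakk>g \<in> topspace (arr G); h \<in> topspace (arr G); src G g = tgt G h\<rbrakk>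
      \<Longrightarrow> tgt G (gcomp G g h) = tgt G g"
    and src_ginv: "g \<in> topspace (arr G) \<Longrightarrow> src G (ginv G g) = tgt G g"
    and tgt_ginv: "g \<in> topspace (arr G) \<Longrightarrow> tgt G (ginv G g) = src G g"
    and gcomp_idt: "g \<in> topspace (arr G) \<Longrightarrow> gcomp G g (idt G (src G g)) = g"
    and idt_gcomp: "g \<in> topspace (arr G) \<Longrightarrow> gcomp G (idt G (tgt G g)) g = g"
    and gcomp_ginv: "g \<in> topspace (arr G) \<Longrightarrow> gcomp G g (ginv G g) = idt G (tgt G g)"
    and ginv_gcomp: "g \<in> topspace (arr G) \<Longrightarrow> gcomp G (ginv G g) g = idt G (src G g)"
    and gcomp_assoc: "\<lbrakk>f \<in> topspace (arr G); g \<in> topspace (arr G); h \<in> topspace (arr G);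
      src G f = tgt G g; src G g = tgt G h\<rbrakk>
      \<Longrightarrow> gcomp G (gcomp G f g) h = gcomp G f (gcomp G g h)"

definition orbit_space :: "('o, 'a) groupoid_data \<Rightarrow> 'o set set" where
  "orbit_space G = topspace (obj G) // {(src G g, tgt G g) |g. g \<in> topspace (arr G)}"

definition transitive_groupoid :: "('o, 'a) groupoid_data \<Rightarrow> bool" where
  "transitive_groupoid G \<longleftrightarrow> is_singleton (orbit_space G)"

(* Only preimages of compact sets are required to be compact, whereas the library's proper_map is
   defined to be closed with compact fibres. *)
definition proper_target :: "('o, 'a) groupoid_data \<Rightarrow> bool" where
  "proper_target G \<longleftrightarrow>
     (\<forall>K. compactin (obj G) K \<longrightarrow> compactin (arr G) {g \<in> topspace (arr G). tgt G g \<in> K})"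

definition isotropy :: "('o, 'a) groupoid_data \<Rightarrow> 'o \<Rightarrow> 'a set" where
  "isotropy G b = {g \<in> topspace (arr G). src G g = b \<and> tgt G g = b}"

definition isotropy_group :: "('o, 'a) groupoid_data \<Rightarrow> 'o \<Rightarrow> 'a monoid" where
  "isotropy_group G b = \<lparr>carrier = isotropy G b, mult = gcomp G, one = idt G b\<rparr>"

(* The topological group of loops at b, regarded as a groupoid with the single object b. *)
definition isotropy_groupoid :: "('o, 'a) groupoid_data \<Rightarrow> 'o \<Rightarrow> ('o, 'a) groupoid_data" where
  "isotropy_groupoid G b =
     G\<lparr>obj := subtopology (obj G) {b}, arr := subtopology (arr G) (isotropy G b)\<rparr>"

definition closed_isotropy_subgroup :: "('o, 'a) groupoid_data \<Rightarrow> 'o \<Rightarrow> 'a set \<Rightarrow> bool" where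
  "closed_isotropy_subgroup G b H \<longleftrightarrow>
     subgroup H (isotropy_group G b) \<and> closedin (subtopology (arr G) (isotropy G b)) H"


record ('o, 'a, 'x) gspace_data =
  pts :: "'x topology"
  anchor :: "'x \<Rightarrow> 'o"
  act :: "'x \<Rightarrow> 'a \<Rightarrow> 'x"

(* act X x g is meaningful when anchor X x = tgt G g. *)
locale right_gspace =
  fixes G :: "('o, 'a) groupoid_data" and X :: "('o, 'a, 'x) gspace_data"
  assumes cg_pts: "cg_space (pts X)"
    and continuous_anchor: "continuous_map (pts X) (obj G) (anchor X)"
    and continuous_act:
      "continuous_map (cg_fibre_prod (pts X) (arr G) (anchor X) (tgt G)) (pts X) (\<lambda>(x, g). act X x g)"
    and anchor_act: "\<lbrakk>x \<in> topspace (pts X); g \<in> topspace (arr G); anchor X x = tgt G g\<rbrakk>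
      \<Longrightarrow> anchor X (act X x g) = src G g"
    and act_idt: "x \<in> topspace (pts X) \<Longrightarrow> act X x (idt G (anchor X x)) = x"
    and act_act: "\<lbrakk>x \<in> topspace (pts X); g \<in> topspace (arr G); h \<in> topspace (arr G);
      anchor X x = tgt G g; src G g = tgt G h\<rbrakk>
      \<Longrightarrow> act X (act X x g) h = act X x (gcomp G g h)"

definition equivariant_map :: "('o, 'a) groupoid_data \<Rightarrow>
    ('o, 'a, 'x) gspace_data \<Rightarrow> ('o, 'a, 'y) gspace_data \<Rightarrow> ('x \<Rightarrow> 'y) \<Rightarrow> bool" where
  "equivariant_map G X Y f \<longleftrightarrow>
     continuous_map (pts X) (pts Y) f \<and>
     (\<forall>x \<in> topspace (pts X). anchor Y (f x) = anchor X x) \<and>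
     (\<forall>x \<in> topspace (pts X). \<forall>g \<in> topspace (arr G).
        anchor X x = tgt G g \<longrightarrow> f (act X x g) = act Y (f x) g)"

definition equivariant_homeo :: "('o, 'a) groupoid_data \<Rightarrow>
    ('o, 'a, 'x) gspace_data \<Rightarrow> ('o, 'a, 'y) gspace_data \<Rightarrow> ('x \<Rightarrow> 'y) \<Rightarrow> bool" where
  "equivariant_homeo G X Y f \<longleftrightarrow> homeomorphic_map (pts X) (pts Y) f \<and> equivariant_map G X Y f"

definition invariant_subset ::
  "('o, 'a) groupoid_data \<Rightarrow> ('o, 'a, 'x) gspace_data \<Rightarrow> 'x set \<Rightarrow> bool" where
  "invariant_subset G X A \<longleftrightarrow> A \<subseteq> topspace (pts X) \<and>
     (\<forall>x \<in> A. \<forall>g \<in> topspace (arr G). anchor X x = tgt G g \<longrightarrow> act X x g \<in> A)"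

definition gs_sub :: "('o, 'a, 'x) gspace_data \<Rightarrow> 'x set \<Rightarrow> ('o, 'a, 'x) gspace_data" where
  "gs_sub X A = X\<lparr>pts := subtopology (pts X) A\<rparr>"

(* The fibre over b; it is acted on by isotropy_groupoid G b. *)
definition gs_fibre :: "('o, 'a, 'x) gspace_data \<Rightarrow> 'o \<Rightarrow> ('o, 'a, 'x) gspace_data" where
  "gs_fibre X b = gs_sub X {x \<in> topspace (pts X). anchor X x = b}"

definition gs_times :: "('o, 'a, 'x) gspace_data \<Rightarrow> 'k topology \<Rightarrow> ('o, 'a, 'x \<times> 'k) gspace_data" where
  "gs_times X K =
     \<lparr>pts = cg_prod (pts X) K, anchor = (\<lambda>(x, k). anchor X x), act = (\<lambda>(x, k) g. (act X x g, k))\<rparr>"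

definition gs_sum ::
  "('i \<Rightarrow> ('o, 'a, 'x) gspace_data) \<Rightarrow> 'i set \<Rightarrow> ('o, 'a, 'i \<times> 'x) gspace_data" where
  "gs_sum X I =
     \<lparr>pts = sum_topology (\<lambda>i. pts (X i)) I,
      anchor = (\<lambda>(i, x). anchor (X i) x), act = (\<lambda>(i, x) g. (i, act (X i) x g))\<rparr>"

definition gs_binary_sum ::
  "('o, 'a, 'x) gspace_data \<Rightarrow> ('o, 'a, 'y) gspace_data \<Rightarrow> ('o, 'a, 'x + 'y) gspace_data" where
  "gs_binary_sum X Y =
     \<lparr>pts = binary_sum_topology (pts X) (pts Y),
      anchor = case_sum (anchor X) (anchor Y),
      act = (\<lambda>z g. case z of Inl x \<Rightarrow> Inl (act X x g) | Inr y \<Rightarrow> Inr (act Y y g))\<rparr>"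

(* The quotient by an equivalence relation whose classes lie in single fibres of the anchor map and
   are permuted by the arrows.  So the anchor of a class is the common anchor of its members, and
   translating a class elementwise gives the class of the translate of any member. *)
definition gs_quotient ::
  "('o, 'a, 'x) gspace_data \<Rightarrow> ('x \<times> 'x) set \<Rightarrow> ('o, 'a, 'x set) gspace_data" where
  "gs_quotient X R =
     \<lparr>pts = quotient_topology (pts X) R,
      anchor = (\<lambda>C. the_elem (anchor X ` C)),
      act = (\<lambda>C g. (\<lambda>x. act X x g) ` C)\<rparr>"

definition target_fibre :: "('o, 'a) groupoid_data \<Rightarrow> 'o \<Rightarrow> ('o, 'a, 'a) gspace_data" where
  "target_fibre G b =
     \<lparr>pts = subtopology (arr G) {f \<in> topspace (arr G). tgt G f = b}, anchor = src G, act = gcomp G\<rparr>"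

definition orbit_cell :: "('o, 'a) groupoid_data \<Rightarrow> 'o \<Rightarrow> 'a set \<Rightarrow> ('o, 'a, 'a set) gspace_data" where
  "orbit_cell G b H =
     gs_quotient (target_fibre G b)
       {(f, gcomp G h f) |f h. f \<in> topspace (pts (target_fibre G b)) \<and> h \<in> H}"

definition pushout_rel ::
  "('o, 'a, 'x) gspace_data \<Rightarrow> ('o, 'a, 'y) gspace_data \<Rightarrow> ('o, 'a, 'z) gspace_data \<Rightarrow>
   ('x \<Rightarrow> 'y) \<Rightarrow> ('x \<Rightarrow> 'z) \<Rightarrow> (('y + 'z) \<times> ('y + 'z)) set" where
  "pushout_rel A Y Z f j =
     {(u, v). u \<in> topspace (pts (gs_binary_sum Y Z)) \<and> v \<in> topspace (pts (gs_binary_sum Y Z)) \<and>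
        equivclp (\<lambda>p q. \<exists>a \<in> topspace (pts A). p = Inl (f a) \<and> q = Inr (j a)) u v}"

(* The pushout of  Y <-f- A -j-> Z:  the disjoint union of Y and Z modulo the equivalence relation
   generated by f a ~ j a.  No Hausdorff quotient is taken: below, the pushout is homeomorphic to a
   subspace of a Hausdorff space, so it is also the pushout among Hausdorff G-spaces. *)
definition gs_pushout ::
  "('o, 'a, 'x) gspace_data \<Rightarrow> ('o, 'a, 'y) gspace_data \<Rightarrow> ('o, 'a, 'z) gspace_data \<Rightarrow>
   ('x \<Rightarrow> 'y) \<Rightarrow> ('x \<Rightarrow> 'z) \<Rightarrow> ('o, 'a, ('y + 'z) set) gspace_data" where
  "gs_pushout A Y Z f j = gs_quotient (gs_binary_sum Y Z) (pushout_rel A Y Z f j)"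

(* Y (with its subset B) arises from its subspace B by attaching finitely many cells of dimension
   n + 1: the pushout is identified with Y by an equivariant homeomorphism which restricts to the
   inclusion of B. *)
definition attaches_cells :: "('o, 'a) groupoid_data \<Rightarrow> 'o \<Rightarrow> nat \<Rightarrow>
    ('o, 'a, 'x) gspace_data \<Rightarrow> 'x set \<Rightarrow> 'x set \<Rightarrow> bool" where
  "attaches_cells G b n X B Y \<longleftrightarrow>
     (\<exists>(k::nat) H (\<phi> :: nat \<Rightarrow> 'a set \<times> (nat \<Rightarrow> real) \<Rightarrow> 'x).
        (\<forall>i<k. closed_isotropy_subgroup G b (H i) \<and>
               equivariant_map G (gs_times (orbit_cell G b (H i)) (nsphere n)) (gs_sub X B) (\<phi> i)) \<and>
        (let S = gs_sum (\<lambda>i. gs_times (orbit_cell G b (H i)) (nsphere n)) {..<k};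
             D = gs_sum (\<lambda>i. gs_times (orbit_cell G b (H i)) (ndisc (Suc n))) {..<k};
             f = (\<lambda>(i, z). \<phi> i z)
         in \<exists>\<theta>. equivariant_homeo G (gs_pushout S (gs_sub X B) D f id) (gs_sub X Y) \<theta> \<and>
                (\<forall>x \<in> B. \<theta> (pushout_rel S (gs_sub X B) D f id `` {Inl x}) = x)))"

(* The skeleta Sk n carry the subspace topology of X; the condition quantifying over U says that X
   has the colimit topology.  Zero cells in a dimension are allowed. *)
definition G_CW_complex ::
  "('o, 'a) groupoid_data \<Rightarrow> 'o \<Rightarrow> ('o, 'a, 'x) gspace_data \<Rightarrow> bool" where
  "G_CW_complex G b X \<longleftrightarrow>
     right_gspace G X \<and>
     (\<exists>Sk :: nat \<Rightarrow> 'x set.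
        (\<forall>n. invariant_subset G X (Sk n)) \<and>
        (\<Union>n. Sk n) = topspace (pts X) \<and>
        (\<forall>U \<subseteq> topspace (pts X).
           openin (pts X) U \<longleftrightarrow> (\<forall>n. openin (subtopology (pts X) (Sk n)) (U \<inter> Sk n))) \<and>
        (\<exists>(k::nat) H \<theta>. (\<forall>i<k. closed_isotropy_subgroup G b (H i)) \<and>
           equivariant_homeo G (gs_sum (\<lambda>i. orbit_cell G b (H i)) {..<k}) (gs_sub X (Sk 0)) \<theta>) \<and>
        (\<forall>n. attaches_cells G b n X (Sk n) (Sk (Suc n))))"

end

theory Submission
  imports Defs
begin

text \<open>
  Properness of the target map makes \<open>G\<^sup>b\<close>, hence \<open>G\<^sup>0 = s(G\<^sup>b)\<close> and all of \<open>G\<^sup>1\<close>, compact. A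
  \<open>G\<close>-map \<open>G\<^sup>b/H \<times> D \<rightarrow> X\<close> is the same as a map \<open>c\<close> from \<open>D\<close> to the \<open>H\<close>-fixed points of \<open>X\<^sub>b\<close>, and
  translating by arrows into \<open>b\<close> turns the condition that the open cells decompose \<open>Y - B\<close> into a
  condition on \<open>c\<close> and the isotropy group alone. Since there are finitely many compact cells in
  each dimension, all skeleta are compact, and a continuous bijection from the pushout onto the
  next skeleton is a homeomorphism; so attaching cells carries no topological information beyond
  the maps \<open>c\<close>, and these are the same for \<open>X\<close> over \<open>G\<close> as for \<open>X\<^sub>b\<close> over the isotropy group.
  The skeleta correspond by intersecting with \<open>X\<^sub>b\<close> and by translating with \<open>G\<^sup>b\<close>. For the colimit
  topology of the translates, a compact subset of \<open>X\<close> has compact translates in \<open>X\<^sub>b\<close>, which lie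
  in a single skeleton, and \<open>X\<close> is compactly generated.
\<close>

section \<open>Point-set topology\<close>

text \<open>The isotropy groupoid at \<open>b\<close> is again a compact transitive groupoid, so one
  characterisation, \<open>G_CW_complex_iff_cell_filtration\<close>, serves both sides; what is left
  is to pass between filtrations of \<open>X\<close> and of its fibre. The obstacle is that
  pushouts, orbit spaces and fibre products are easy either to map out of or to map into, but not
  both. Continuity of an inverse is never checked by hand: a continuous surjection from a compact
  space onto a Hausdorff one is closed, hence a quotient map, and the quotient by its kernel is its
  image. The price is that the lower skeleton must be known to be compact before cells are attached,
  so compactness is carried along by induction on the dimension. The action is continuous only on a
  kified fibre product. A k-space does not notice the kification of a target, and compact spaces are
  k-spaces, so the action is composed with maps out of compact spaces: the product of a target fibre
  with a disc, or a compact set of pairs of a point and an arrow.\<close>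

lemma nsphere_eq_subtopology_ndisc:
  "nsphere n = subtopology (ndisc (Suc n)) (topspace (nsphere n))"
proof -
  \<comment> \<open>The sphere sums over \<open>{..n}\<close> and the disc over
    \<open>{..<Suc n}\<close>, which are the same coordinates.\<close>
  have *: "{x::nat \<Rightarrow> real. (\<Sum>i<Suc n. x i ^ 2) \<le> 1} \<inter> topspace (nsphere n) = topspace (nsphere n)"
    by (auto simp: nsphere_def lessThan_Suc_atMost)
  show ?thesis
    unfolding ndisc_def subtopology_subtopology *
    by (simp add: nsphere_def subtopology_restrict)
qed

lemma topspace_nsphere_subset_ndisc: "topspace (nsphere n) \<subseteq> topspace (ndisc (Suc n))"
  by (metis nsphere_eq_subtopology_ndisc Int_lower1 topspace_subtopology)

text \<open>Used with \<open>C = {..1}\<close> for the disc and \<open>C = {1}\<close> for the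
  sphere.\<close>

lemma closedin_powertop_real_sum_squares:
  fixes n :: nat
  assumes "closed C"
  shows "closedin (powertop_real UNIV) {x. (\<Sum>i<n. x i ^ 2) \<in> C}"
proof -
  have "continuous_map (powertop_real UNIV) euclideanreal (\<lambda>x. \<Sum>i<n. x i ^ 2)"
    by (intro continuous_map_sum continuous_map_real_pow continuous_map_product_projection finite_lessThan) auto
  from closedin_continuous_map_preimage[OF this] assms show ?thesis
    by simp
qed

text \<open>A closed subset of the cube with all coordinates in [-1,1], which is compact by
  Tychonoff. The cube has infinitely many factors, but coordinates from \<open>n\<close> on vanish
  on \<open>Euclidean_space n\<close>.\<close>

lemma compact_space_ndisc: "compact_space (ndisc n)"
proof -
  let ?B = "{x::nat \<Rightarrow> real. (\<Sum>i<n. x i ^ 2) \<le> 1}"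
  let ?S = "topspace (Euclidean_space n) \<inter> ?B"
  have "closedin (powertop_real UNIV) ?B"
    using closedin_powertop_real_sum_squares[of "{..1}" n] by simp
  then have closed: "closedin (powertop_real UNIV) ?S"
    using closedin_Euclidean_space by blast
  have compact: "compactin (powertop_real UNIV) (PiE UNIV (\<lambda>_. {-1..1::real}))"
    by (simp add: compactin_PiE)
  have "?S \<subseteq> PiE UNIV (\<lambda>_. {-1..1})"
  proof
    fix x assume x: "x \<in> ?S"
    have "\<bar>x i\<bar> \<le> 1" for i
    proof (cases "i < n")
      case True
      then have "x i ^ 2 \<le> (\<Sum>i<n. x i ^ 2)"
        by (intro member_le_sum) auto
      then show ?thesis
        using x abs_square_le_1[of "x i"] by auto
    next
      case False
      then show ?thesis
        using x by (simp add: topspace_Euclidean_space)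
    qed
    then show "x \<in> PiE UNIV (\<lambda>_. {-1..1})"
      by (auto simp: abs_le_iff minus_le_iff)
  qed
  then have "compactin (powertop_real UNIV) ?S"
    using closed compact closed_compactin by blast
  moreover have "ndisc n = subtopology (powertop_real UNIV) ?S"
    by (simp add: ndisc_def Euclidean_space_def subtopology_subtopology)
  ultimately show ?thesis
    by (simp add: compact_space_subtopology)
qed

lemma Hausdorff_space_ndisc: "Hausdorff_space (ndisc n)"
  unfolding ndisc_def Euclidean_space_def
  by (intro Hausdorff_space_subtopology) (simp add: Hausdorff_space_product_topology)

lemma compact_space_nsphere: "compact_space (nsphere n)"
proof -
  have "topspace (nsphere n) = topspace (Euclidean_space (Suc n)) \<inter> {x. (\<Sum>i<Suc n. x i ^ 2) = 1}"
    by (simp add: nsphere_def lessThan_Suc_atMost)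
  moreover have "closedin (powertop_real UNIV) {x. (\<Sum>i<Suc n. x i ^ 2) = 1}"
    using closedin_powertop_real_sum_squares[of "{1}" "Suc n"] by simp
  ultimately have "closedin (powertop_real UNIV) (topspace (nsphere n))"
    using closedin_Int[OF closedin_Euclidean_space[of "Suc n"]] by presburger
  then have "closedin (ndisc (Suc n)) (topspace (nsphere n))"
    unfolding ndisc_def Euclidean_space_def subtopology_subtopology
    by (rule closedin_subset_topspace)
      (use topspace_nsphere_subset_ndisc[of n] in \<open>simp add: ndisc_def Euclidean_space_def\<close>)
  then have "compact_space (subtopology (ndisc (Suc n)) (topspace (nsphere n)))"
    by (intro compact_space_subtopology closedin_compact_space compact_space_ndisc)
  then show ?thesis
    by (simp only: nsphere_eq_subtopology_ndisc[symmetric])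
qed

section \<open>Quotient topologies and kernels of quotient maps\<close>

lemma topspace_quotient_topology:
  assumes "equiv (topspace T) R"
  shows "topspace (quotient_topology T R) = topspace T // R"
proof -
  have "{x \<in> topspace T. R `` {x} \<in> topspace T // R} = topspace T"
    by (auto simp: quotientI)
  then have "openin (quotient_topology T R) (topspace T // R)"
    by (simp add: openin_quotient_topology)
  then show ?thesis
    by (metis openin_quotient_topology openin_subset openin_topspace subset_antisym)
qed

lemma quotient_map_quotient_topology:
  assumes "equiv (topspace T) R"
  shows "quotient_map T (quotient_topology T R) (\<lambda>x. R `` {x})"
proof -
  have "(\<lambda>x. R `` {x}) ` topspace T = topspace (quotient_topology T R)"
    unfolding topspace_quotient_topology[OF assms] by (auto simp: quotient_def)
  then show ?thesis
    unfolding quotient_map_def openin_quotient_topology topspace_quotient_topology[OF assms]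
    by blast
qed

text \<open>Anchors of classes, orbit extensions and maps out of pushouts are all encoded by
  \<open>the_elem\<close> of an image; this turns constancy on classes into the expected
  value.\<close>

lemma the_elem_image_class:
  assumes "equiv A R" "x \<in> A" "\<And>u v. (u, v) \<in> R \<Longrightarrow> p u = p v"
  shows "the_elem (p ` (R `` {x})) = p x"
proof -
  have "p ` (R `` {x}) = {p x}"
  proof (rule equalityI)
    show "p ` (R `` {x}) \<subseteq> {p x}"
      using assms(3)[of x] by force
    show "{p x} \<subseteq> p ` (R `` {x})"
      using equiv_class_self[OF assms(1,2)] by blast
  qed
  then show ?thesis
    by simp
qed

lemma equiv_kernel: "equiv A {(u, v). u \<in> A \<and> v \<in> A \<and> p u = p v}"
  by (intro equivI) (auto simp: refl_on_def sym_def trans_def)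

text \<open>The induced map composed with the projection is \<open>p\<close>, so it is a quotient
  map by cancellation; dividing by exactly the kernel makes it injective.\<close>

lemma homeomorphic_map_quotient_kernel:
  assumes p: "quotient_map T T' p"
    and R: "R = {(u, v). u \<in> topspace T \<and> v \<in> topspace T \<and> p u = p v}"
  shows "homeomorphic_map (quotient_topology T R) T' (\<lambda>C. the_elem (p ` C))"
proof -
  let ?h = "\<lambda>C. the_elem (p ` C)"
  have eq: "equiv (topspace T) R"
    unfolding R by (rule equiv_kernel)
  note q = quotient_map_quotient_topology[OF eq]
  have hq: "?h (R `` {x}) = p x" if "x \<in> topspace T" for x
    by (rule the_elem_image_class[OF eq that]) (simp add: R)
  have "quotient_map T T' (?h \<circ> (\<lambda>x. R `` {x}))"
    using p by (rule quotient_map_eq) (simp add: hq)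
  then have "quotient_map (quotient_topology T R) T' ?h"
    using quotient_map_compose_eq[OF q] by blast
  moreover have "inj_on ?h (topspace (quotient_topology T R))"
  proof (rule inj_onI)
    fix C D
    assume "C \<in> topspace (quotient_topology T R)" "D \<in> topspace (quotient_topology T R)"
      and h: "?h C = ?h D"
    then obtain x y where "x \<in> topspace T" "C = R `` {x}" "y \<in> topspace T" "D = R `` {y}"
      by (auto simp: topspace_quotient_topology[OF eq] quotient_def)
    then show "C = D"
      using h by (simp add: hq) (simp add: R)
  qed
  ultimately show ?thesis
    unfolding homeomorphic_map_def by blast
qed

section \<open>Disjoint unions of two or finitely many spaces\<close>

lemma topspace_binary_sum_topology:
  "topspace (binary_sum_topology S T) = topspace S <+> topspace T"
proof -
  have "Inl -` (topspace S <+> topspace T) = topspace S"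
    "Inr -` (topspace S <+> topspace T) = topspace T"
    by auto
  then have "openin (binary_sum_topology S T) (topspace S <+> topspace T)"
    by (simp add: openin_binary_sum_topology)
  moreover have "U \<subseteq> topspace S <+> topspace T" if "openin (binary_sum_topology S T) U" for U
  proof
    fix z assume "z \<in> U"
    moreover have "Inl -` U \<subseteq> topspace S" "Inr -` U \<subseteq> topspace T"
      using that by (auto simp: openin_binary_sum_topology dest: openin_subset)
    ultimately show "z \<in> topspace S <+> topspace T"
      by (cases z) auto
  qed
  ultimately show ?thesis
    by (metis openin_subset openin_topspace subset_antisym)
qed

lemma continuous_map_Inl: "continuous_map S (binary_sum_topology S T) Inl"
  unfolding continuous_map_def
proof (intro conjI allI impI)
  show "Inl \<in> topspace S \<rightarrow> topspace (binary_sum_topology S T)"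
    by (auto simp: topspace_binary_sum_topology)
next
  fix U assume "openin (binary_sum_topology S T) U"
  then have U: "openin S (Inl -` U)"
    by (simp add: openin_binary_sum_topology)
  then have "{x \<in> topspace S. Inl x \<in> U} = Inl -` U"
    using openin_subset by blast
  with U show "openin S {x \<in> topspace S. Inl x \<in> U}"
    by simp
qed

lemma continuous_map_Inr: "continuous_map T (binary_sum_topology S T) Inr"
  unfolding continuous_map_def
proof (intro conjI allI impI)
  show "Inr \<in> topspace T \<rightarrow> topspace (binary_sum_topology S T)"
    by (auto simp: topspace_binary_sum_topology)
next
  fix U assume "openin (binary_sum_topology S T) U"
  then have U: "openin T (Inr -` U)"
    by (simp add: openin_binary_sum_topology)
  then have "{x \<in> topspace T. Inr x \<in> U} = Inr -` U"
    using openin_subset by blast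
  with U show "openin T {x \<in> topspace T. Inr x \<in> U}"
    by simp
qed

lemma continuous_map_case_sum:
  assumes "continuous_map S Z f" "continuous_map T Z g"
  shows "continuous_map (binary_sum_topology S T) Z (case_sum f g)"
proof -
  have "Inl -` {z \<in> topspace (binary_sum_topology S T). case_sum f g z \<in> U} =
      {x \<in> topspace S. f x \<in> U}"
    "Inr -` {z \<in> topspace (binary_sum_topology S T). case_sum f g z \<in> U} =
      {x \<in> topspace T. g x \<in> U}" for U
    by (auto simp: topspace_binary_sum_topology)
  moreover have "case_sum f g \<in> topspace (binary_sum_topology S T) \<rightarrow> topspace Z"
    using assms[THEN continuous_map_funspace] by (auto simp: topspace_binary_sum_topology)
  ultimately show ?thesis
    using assms unfolding continuous_map_def openin_binary_sum_topology by simp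
qed

lemma compact_space_binary_sum:
  assumes "compact_space S" "compact_space T"
  shows "compact_space (binary_sum_topology S T)"
proof -
  have "topspace (binary_sum_topology S T) = Inl ` topspace S \<union> Inr ` topspace T"
    by (auto simp: topspace_binary_sum_topology)
  then show ?thesis
    using assms unfolding compact_space_def
    by (metis compactin_Un continuous_map_Inl continuous_map_Inr image_compactin)
qed

lemma continuous_map_from_sum_topology:
  assumes "\<And>i. i \<in> I \<Longrightarrow> continuous_map (X i) Z (f i)"
  shows "continuous_map (sum_topology X I) Z (\<lambda>(i, x). f i x)"
proof -
  have "{x. (i, x) \<in> {z \<in> topspace (sum_topology X I). (case z of (i, x) \<Rightarrow> f i x) \<in> U}} =
      {x \<in> topspace (X i). f i x \<in> U}" if "i \<in> I" for i U
    using that by auto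
  moreover have "(\<lambda>(i, x). f i x) \<in> topspace (sum_topology X I) \<rightarrow> topspace Z"
    using assms[THEN continuous_map_funspace] by fastforce
  moreover have "{z \<in> topspace (sum_topology X I). P z} \<subseteq> Sigma I (topspace \<circ> X)" for P
    by auto
  ultimately show ?thesis
    using assms unfolding continuous_map_def openin_sum_topology by simp
qed

lemma compact_space_sum_topology:
  assumes "finite I" "\<And>i. i \<in> I \<Longrightarrow> compact_space (X i)"
  shows "compact_space (sum_topology X I)"
proof -
  have "compactin (sum_topology X I) (\<Union>i\<in>I. Pair i ` topspace (X i))"
    using assms
    by (intro compactin_Union)
      (auto simp: compact_space_def intro: image_compactin continuous_map_component_injection)
  moreover have "(\<Union>i\<in>I. Pair i ` topspace (X i)) = topspace (sum_topology X I)"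
    by auto
  ultimately show ?thesis
    by (simp add: compact_space_def)
qed

text \<open>Traces of open sets are always open, so only one implication of the colimit condition
  has content. It is moved to complements because compactness arguments produce closed sets.\<close>

lemma openin_union_iff_closedin_union:
  assumes "(\<Union>n. S n) = topspace X"
  shows "(\<forall>U \<subseteq> topspace X. openin X U \<longleftrightarrow> (\<forall>n. openin (subtopology X (S n)) (U \<inter> S n))) \<longleftrightarrow>
    (\<forall>C \<subseteq> topspace X. (\<forall>n. closedin (subtopology X (S n)) (C \<inter> S n)) \<longrightarrow> closedin X C)"
proof -
  have S: "topspace X \<inter> S n = S n" for n
    using assms by blast
  have *: "closedin (subtopology X (S n)) (C \<inter> S n) \<longleftrightarrow>
      openin (subtopology X (S n)) ((topspace X - C) \<inter> S n)" for C n
  proof -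
    have "S n - C \<inter> S n = (topspace X - C) \<inter> S n"
      using S[of n] by auto
    then show ?thesis
      by (simp add: closedin_def S)
  qed
  show ?thesis (is "?L \<longleftrightarrow> ?R")
  proof
    assume L: ?L
    show ?R
      unfolding * using L by (metis Diff_subset closedin_def)
  next
    assume R: ?R
    show ?L
    proof (intro allI impI iffI)
      fix U n assume "openin X U"
      then show "openin (subtopology X (S n)) (U \<inter> S n)"
        by (rule openin_subtopology_Int)
    next
      fix U assume U: "U \<subseteq> topspace X" "\<forall>n. openin (subtopology X (S n)) (U \<inter> S n)"
      then have "closedin X (topspace X - U)"
        using R[rule_format, of "topspace X - U"] by (simp add: * double_diff)
      then show "openin X U"
        using U(1) by (simp add: openin_closedin_eq)
    qed
  qed
qed

text \<open>Otherwise \<open>K\<close> contains a sequence leaving every stage. Its tails meet each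
  stage in a finite set, so they are closed by T1 and the colimit topology, and the complements of
  the tails cover \<open>K\<close> without a finite subcover.\<close>

lemma compactin_subset_of_colimit:
  fixes S :: "nat \<Rightarrow> 'p set"
  assumes T1: "t1_space X" and mono: "\<And>n. S n \<subseteq> S (Suc n)" and Un: "(\<Union>n. S n) = topspace X"
    and colim: "\<And>C. \<lbrakk>C \<subseteq> topspace X; \<And>n. closedin (subtopology X (S n)) (C \<inter> S n)\<rbrakk>
      \<Longrightarrow> closedin X C"
    and K: "compactin X K"
  shows "\<exists>n. K \<subseteq> S n"
proof (rule ccontr)
  assume "\<nexists>n. K \<subseteq> S n"
  then have "\<forall>n. \<exists>x. x \<in> K - S n"
    by blast
  then obtain x where x: "\<And>n. x n \<in> K - S n"
    by metis
  have le: "S m \<subseteq> S n" if "m \<le> n" for m n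
    using that mono by (rule lift_Suc_mono_le[rotated])
  have KX: "K \<subseteq> topspace X"
    using K by (rule compactin_subset_topspace)
  define F where "F n = x ` {n..}" for n
  have F_S: "F n \<inter> S m \<subseteq> x ` {..<m}" for n m
  proof
    fix y assume "y \<in> F n \<inter> S m"
    then obtain i where "y = x i" "x i \<in> S m"
      by (auto simp: F_def)
    then show "y \<in> x ` {..<m}"
      using x[of i] le[of m i] by (cases "m \<le> i") auto
  qed
  have closed: "closedin X (F n)" for n
  proof (rule colim)
    show "F n \<subseteq> topspace X"
      using x KX by (auto simp: F_def)
    fix m
    have "finite (F n \<inter> S m)"
      using F_S finite_subset by blast
    moreover have "t1_space (subtopology X (S m))"
      using T1 by (rule t1_space_subtopology)
    moreover have "F n \<inter> S m \<subseteq> topspace (subtopology X (S m))"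
      using Un by auto
    ultimately show "closedin (subtopology X (S m)) (F n \<inter> S m)"
      by (simp add: t1_space_closedin_finite)
  qed
  have "K \<subseteq> (\<Union>n. topspace X - F n)"
  proof
    fix y assume "y \<in> K"
    then have "y \<in> topspace X"
      using KX by blast
    then obtain m where m: "y \<in> S m"
      using Un by blast
    \<comment> \<open>A member of \<open>F m\<close> is some \<open>x i\<close> with
      \<open>m \<le> i\<close>, which avoids \<open>S i\<close> and therefore the smaller
      \<open>S m\<close>.\<close>
    have "y \<notin> F m"
      using m x le by (fastforce simp: F_def)
    then show "y \<in> (\<Union>n. topspace X - F n)"
      using \<open>y \<in> topspace X\<close> by blast
  qed
  moreover have "\<forall>U \<in> range (\<lambda>n. topspace X - F n). openin X U"
    using closed by auto
  ultimately obtain \<F> where "finite \<F>" "\<F> \<subseteq> range (\<lambda>n. topspace X - F n)" "K \<subseteq> \<Union>\<F>"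
    using K compactinD[of X K "range (\<lambda>n. topspace X - F n)"] by blast
  then obtain J where J: "finite J" "K \<subseteq> (\<Union>n\<in>J. topspace X - F n)"
    by (metis finite_subset_image)
  \<comment> \<open>Beyond all indices of the subcover, \<open>x N\<close> belongs to every tail
    whose complement was used.\<close>
  obtain N where "\<forall>n\<in>J. n \<le> N"
    using J(1) finite_nat_set_iff_bounded_le by blast
  then have "x N \<in> F n" if "n \<in> J" for n
    using that by (auto simp: F_def)
  then show False
    using J(2) x[of N] by blast
qed

section \<open>Groupoid actions\<close>

lemma topspace_cg_fibre_prod:
  "topspace (cg_fibre_prod S T f g) = {(x, y). x \<in> topspace S \<and> y \<in> topspace T \<and> f x = g y}"
  by (auto simp: cg_fibre_prod_def)

text \<open>Continuity into a kification can be tested before kifying only when the source is a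
  k-space; the applications use compact sources.\<close>

lemma continuous_map_into_cg_fibre_prod:
  assumes "k_space Z" "continuous_map Z S p" "continuous_map Z T q"
    and "\<And>z. z \<in> topspace Z \<Longrightarrow> f (p z) = g (q z)"
  shows "continuous_map Z (cg_fibre_prod S T f g) (\<lambda>z. (p z, q z))"
  unfolding cg_fibre_prod_def continuous_map_into_kification[OF assms(1)]
  using assms by (auto simp: continuous_map_in_subtopology intro: continuous_map_pairedI)

text \<open>Restricts composition and actions to the isotropy group and the fibre. Kification need
  not commute with subspaces, so the restriction is a composite with the identity map, which remains
  continuous when both sides are kified.\<close>

lemma continuous_map_cg_fibre_prod_subtopology:
  assumes cont: "continuous_map (cg_fibre_prod S T f g) Z m"
    and image: "\<And>x y. \<lbrakk>x \<in> topspace S; y \<in> topspace T; x \<in> A; y \<in> B; f x = g y\<rbrakk> \<Longrightarrow> m (x, y) \<in> C"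
  shows "continuous_map (cg_fibre_prod (subtopology S A) (subtopology T B) f g) (subtopology Z C) m"
proof -
  let ?P = "cg_fibre_prod (subtopology S A) (subtopology T B) f g"
  have "continuous_map (prod_topology (subtopology S A) (subtopology T B)) (prod_topology S T) id"
    by (simp add: continuous_map_from_subtopology flip: subtopology_Times)
  then have "continuous_map ?P (cg_fibre_prod S T f g) id"
    unfolding cg_fibre_prod_def
    by (intro continuous_map_kification)
      (auto simp: continuous_map_in_subtopology intro: continuous_map_from_subtopology)
  from continuous_map_compose[OF this cont] have "continuous_map ?P Z m"
    by simp
  then show ?thesis
    using image by (auto simp: continuous_map_in_subtopology topspace_cg_fibre_prod)
qed

lemma compact_space_prod_topology_intro:
  "\<lbrakk>compact_space S; compact_space T\<rbrakk> \<Longrightarrow> compact_space (prod_topology S T)"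
  by (simp add: compact_space_prod_topology)

text \<open>Lets cells be treated as ordinary products, since both factors of a cell are
  compact.\<close>

lemma cg_prod_compact:
  assumes "compact_space S" "compact_space T"
  shows "cg_prod S T = prod_topology S T"
  unfolding cg_prod_def kification_eq_self
  by (intro compact_imp_k_space compact_space_prod_topology_intro assms)

lemma topspace_cg_prod [simp]: "topspace (cg_prod S T) = topspace S \<times> topspace T"
  by (simp add: cg_prod_def)

text \<open>The algebraic part of a right \<open>G\<close>-space. It passes to quotients by congruences without
  any separation hypothesis.\<close>
locale gspace_action =
  fixes G :: "('o, 'a) groupoid_data" and X :: "('o, 'a, 'x) gspace_data"
  assumes anchor_in_obj: "x \<in> topspace (pts X) \<Longrightarrow> anchor X x \<in> topspace (obj G)"
    and act_in_pts: "\<lbrakk>x \<in> topspace (pts X); g \<in> topspace (arr G); anchor X x = tgt G g\<rbrakk>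
      \<Longrightarrow> act X x g \<in> topspace (pts X)"
    and anchor_act: "\<lbrakk>x \<in> topspace (pts X); g \<in> topspace (arr G); anchor X x = tgt G g\<rbrakk>
      \<Longrightarrow> anchor X (act X x g) = src G g"
    and act_idt: "x \<in> topspace (pts X) \<Longrightarrow> act X x (idt G (anchor X x)) = x"
    and act_act: "\<lbrakk>x \<in> topspace (pts X); g \<in> topspace (arr G); h \<in> topspace (arr G);
      anchor X x = tgt G g; src G g = tgt G h\<rbrakk>
      \<Longrightarrow> act X (act X x g) h = act X x (gcomp G g h)"

text \<open>These are the conditions under which anchor and action in \<open>gs_quotient\<close> can
  be computed on representatives.\<close>

definition gspace_congruence ::
  "('o, 'a) groupoid_data \<Rightarrow> ('o, 'a, 'x) gspace_data \<Rightarrow> ('x \<times> 'x) set \<Rightarrow> bool" where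
  "gspace_congruence G X R \<longleftrightarrow> equiv (topspace (pts X)) R \<and>
     (\<forall>(u, v) \<in> R. anchor X u = anchor X v \<and>
       (\<forall>g \<in> topspace (arr G). anchor X u = tgt G g \<longrightarrow> (act X u g, act X v g) \<in> R))"

text \<open>No axioms are asked of \<open>q\<close> and \<open>a\<close>. So \<open>p\<close> may be
  an equivariant map onto a subspace of a G-space, or merely the normal form function of a
  pushout.\<close>

lemma gspace_congruence_kernel:
  assumes X: "gspace_action G X"
    and anchor: "\<And>u. u \<in> topspace (pts X) \<Longrightarrow> q (p u) = anchor X u"
    and act: "\<And>u g. \<lbrakk>u \<in> topspace (pts X); g \<in> topspace (arr G); anchor X u = tgt G g\<rbrakk>
      \<Longrightarrow> p (act X u g) = a (p u) g"
  shows "gspace_congruence G X {(u, v). u \<in> topspace (pts X) \<and> v \<in> topspace (pts X) \<and> p u = p v}"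
proof -
  have "anchor X u = anchor X v \<and>
      (\<forall>g \<in> topspace (arr G). anchor X u = tgt G g \<longrightarrow> act X u g \<in> topspace (pts X) \<and>
         act X v g \<in> topspace (pts X) \<and> p (act X u g) = p (act X v g))"
    if "u \<in> topspace (pts X)" "v \<in> topspace (pts X)" "p u = p v" for u v
  proof -
    have "anchor X u = anchor X v"
      using anchor that by metis
    then show ?thesis
      using that act gspace_action.act_in_pts[OF X] by simp
  qed
  then show ?thesis
    unfolding gspace_congruence_def by (auto intro: equiv_kernel)
qed

lemma equivariant_map_gs_sub:
  "equivariant_map G X (gs_sub Y B) f \<longleftrightarrow>
     equivariant_map G X Y f \<and> f ` topspace (pts X) \<subseteq> B"
  by (auto simp: equivariant_map_def gs_sub_def continuous_map_in_subtopology)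

lemma equivariant_map_compose:
  assumes "equivariant_map G X Y f" "equivariant_map G Y Z g"
  shows "equivariant_map G X Z (g \<circ> f)"
  using assms continuous_map_image_subset_topspace[of "pts X" "pts Y" f]
  unfolding equivariant_map_def by (auto intro: continuous_map_compose)

lemma gspace_action_gs_times:
  assumes "gspace_action G X"
  shows "gspace_action G (gs_times X K)"
  using assms by (auto simp: gspace_action_def gs_times_def)

lemma gspace_action_gs_sum:
  assumes "\<And>i. i \<in> I \<Longrightarrow> gspace_action G (X i)"
  shows "gspace_action G (gs_sum X I)"
  using assms by (auto simp: gspace_action_def gs_sum_def)

lemma gspace_action_gs_binary_sum:
  assumes "gspace_action G X" "gspace_action G Y"
  shows "gspace_action G (gs_binary_sum X Y)"
  using assms
  by (auto simp: gspace_action_def gs_binary_sum_def topspace_binary_sum_topology)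

lemma gspace_action_gs_sub:
  assumes "gspace_action G X" "invariant_subset G X A"
  shows "gspace_action G (gs_sub X A)"
  using assms
  by (auto simp: gspace_action_def gs_sub_def invariant_subset_def)

lemma right_gspace_imp_gspace_action:
  assumes "right_gspace G X"
  shows "gspace_action G X"
proof -
  interpret right_gspace G X by fact
  show ?thesis
  proof
    fix x g
    assume "x \<in> topspace (pts X)" "g \<in> topspace (arr G)" "anchor X x = tgt G g"
    then show "act X x g \<in> topspace (pts X)"
      using funcset_mem[OF continuous_map_funspace[OF continuous_act], of "(x, g)"]
      by (simp add: topspace_cg_fibre_prod)
  next
    fix x
    assume "x \<in> topspace (pts X)"
    then show "anchor X x \<in> topspace (obj G)"
      using continuous_map_funspace[OF continuous_anchor] by auto
  qed (fact anchor_act act_idt act_act)+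
qed

section \<open>Groupoid algebra and quotients of actions by congruences\<close>

context topological_groupoid
begin

lemma idt_in_arr [simp]: "x \<in> topspace (obj G) \<Longrightarrow> idt G x \<in> topspace (arr G)"
  using continuous_map_funspace[OF continuous_idt] by auto

lemma src_in_obj [simp]: "g \<in> topspace (arr G) \<Longrightarrow> src G g \<in> topspace (obj G)"
  using continuous_map_funspace[OF continuous_src] by auto

lemma tgt_in_obj [simp]: "g \<in> topspace (arr G) \<Longrightarrow> tgt G g \<in> topspace (obj G)"
  using continuous_map_funspace[OF continuous_tgt] by auto

lemma ginv_in_arr [simp]: "g \<in> topspace (arr G) \<Longrightarrow> ginv G g \<in> topspace (arr G)"
  using continuous_map_funspace[OF continuous_ginv] by auto

lemma gcomp_in_arr [simp]:
  "\<lbrakk>g \<in> topspace (arr G); h \<in> topspace (arr G); src G g = tgt G h\<rbrakk>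
    \<Longrightarrow> gcomp G g h \<in> topspace (arr G)"
  using funcset_mem[OF continuous_map_funspace[OF continuous_gcomp], of "(g, h)"]
  by (simp add: topspace_cg_fibre_prod)

lemmas structure_simps [simp] = src_idt tgt_idt src_gcomp tgt_gcomp src_ginv tgt_ginv

lemma ginv_gcomp_cancel:
  "\<lbrakk>g \<in> topspace (arr G); h \<in> topspace (arr G); src G g = tgt G h\<rbrakk>
    \<Longrightarrow> gcomp G (ginv G g) (gcomp G g h) = h"
  by (metis gcomp_assoc ginv_gcomp ginv_in_arr idt_gcomp src_ginv)

lemma gcomp_ginv_cancel_right:
  "\<lbrakk>g \<in> topspace (arr G); h \<in> topspace (arr G); src G g = src G h\<rbrakk>
    \<Longrightarrow> gcomp G (gcomp G g (ginv G h)) h = g"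
  by (metis gcomp_assoc gcomp_idt ginv_gcomp ginv_in_arr src_ginv tgt_ginv)

lemma act_ginv_cancel:
  assumes "gspace_action G X" "x \<in> topspace (pts X)" "g \<in> topspace (arr G)" "anchor X x = tgt G g"
  shows "act X (act X x g) (ginv G g) = x"
proof -
  interpret gspace_action G X by fact
  show ?thesis
    using assms by (metis act_act act_idt gcomp_ginv ginv_in_arr tgt_ginv)
qed

lemma act_ginv_cancel':
  assumes "gspace_action G X" "x \<in> topspace (pts X)" "g \<in> topspace (arr G)" "anchor X x = src G g"
  shows "act X (act X x (ginv G g)) g = x"
proof -
  interpret gspace_action G X by fact
  show ?thesis
    using assms by (metis act_act act_idt ginv_gcomp ginv_in_arr src_ginv tgt_ginv)
qed

lemma isotropyD:
  assumes "g \<in> isotropy G b"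
  shows "g \<in> topspace (arr G)" "src G g = b" "tgt G g = b"
  using assms by (auto simp: isotropy_def)

lemma group_isotropy_group:
  assumes "b \<in> topspace (obj G)"
  shows "group (isotropy_group G b)"
proof (rule groupI)
  fix g assume "g \<in> carrier (isotropy_group G b)"
  then have g: "g \<in> isotropy G b"
    by (simp add: isotropy_group_def)
  then have "ginv G g \<in> isotropy G b" "gcomp G (ginv G g) g = idt G b"
    by (auto simp: isotropy_def ginv_gcomp)
  then show "\<exists>h\<in>carrier (isotropy_group G b). h \<otimes>\<^bsub>isotropy_group G b\<^esub> g = \<one>\<^bsub>isotropy_group G b\<^esub>"
    by (auto simp: isotropy_group_def)
  show "\<one>\<^bsub>isotropy_group G b\<^esub> \<otimes>\<^bsub>isotropy_group G b\<^esub> g = g"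
    using isotropyD[OF g] idt_gcomp[of g] by (simp add: isotropy_group_def)
qed (use assms in \<open>auto simp: isotropy_group_def isotropy_def gcomp_assoc\<close>)

lemma closed_isotropy_subgroupD:
  assumes b: "b \<in> topspace (obj G)" and H: "closed_isotropy_subgroup G b H"
  shows "H \<subseteq> isotropy G b" "idt G b \<in> H"
    "\<And>g h. \<lbrakk>g \<in> H; h \<in> H\<rbrakk> \<Longrightarrow> gcomp G g h \<in> H" "\<And>h. h \<in> H \<Longrightarrow> ginv G h \<in> H"
proof -
  interpret group "isotropy_group G b"
    using b by (rule group_isotropy_group)
  interpret subgroup H "isotropy_group G b"
    using H by (simp add: closed_isotropy_subgroup_def)
  show sub: "H \<subseteq> isotropy G b"
    using subset by (simp add: isotropy_group_def)
  show "idt G b \<in> H"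
    using one_closed by (simp add: isotropy_group_def)
  show "gcomp G g h \<in> H" if "g \<in> H" "h \<in> H" for g h
    using m_closed[OF that] by (simp add: isotropy_group_def)
  show "ginv G h \<in> H" if "h \<in> H" for h
  proof -
    have h: "h \<in> isotropy G b" "ginv G h \<in> isotropy G b"
      using that sub by (auto simp: isotropy_def)
    then have "inv\<^bsub>isotropy_group G b\<^esub> h = ginv G h"
      by (intro inv_equality) (auto simp: isotropy_group_def isotropy_def ginv_gcomp)
    then show ?thesis
      using m_inv_closed[OF that] by simp
  qed
qed

lemma gspace_action_target_fibre:
  "gspace_action G (target_fibre G b)"
  by standard (auto simp: target_fibre_def gcomp_idt gcomp_assoc)

text \<open>Translating a class elementwise lands in the class of the translate by congruence. It
  fills that class because a member \<open>v\<close> can be translated back by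
  \<open>ginv G g\<close> into the original class.\<close>

lemma
  assumes X: "gspace_action G X" and R: "gspace_congruence G X R" and x: "x \<in> topspace (pts X)"
  shows anchor_gs_quotient: "anchor (gs_quotient X R) (R `` {x}) = anchor X x"
    and act_gs_quotient: "\<lbrakk>g \<in> topspace (arr G); anchor X x = tgt G g\<rbrakk>
      \<Longrightarrow> act (gs_quotient X R) (R `` {x}) g = R `` {act X x g}"
proof -
  interpret gspace_action G X by fact
  have eq: "equiv (topspace (pts X)) R"
    and anchor_eq: "\<And>u v. (u, v) \<in> R \<Longrightarrow> anchor X u = anchor X v"
    and act_rel: "\<And>u v g. \<lbrakk>(u, v) \<in> R; g \<in> topspace (arr G); anchor X u = tgt G g\<rbrakk>
      \<Longrightarrow> (act X u g, act X v g) \<in> R"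
    using R by (auto simp: gspace_congruence_def)
  show "anchor (gs_quotient X R) (R `` {x}) = anchor X x"
    using the_elem_image_class[OF eq x anchor_eq] by (simp add: gs_quotient_def)
  show "act (gs_quotient X R) (R `` {x}) g = R `` {act X x g}"
    if g: "g \<in> topspace (arr G)" "anchor X x = tgt G g"
  proof -
    have "v \<in> (\<lambda>u. act X u g) ` (R `` {x})" if v: "(act X x g, v) \<in> R" for v
    proof (rule image_eqI)
      have "v \<in> topspace (pts X)" "anchor X v = src G g"
        using v eq anchor_eq[OF v] anchor_act[OF x g] by (auto dest: equiv_type)
      then show "v = act X (act X v (ginv G g)) g"
        using g X by (simp add: act_ginv_cancel')
      have "(act X (act X x g) (ginv G g), act X v (ginv G g)) \<in> R"
        using act_rel[OF v] g anchor_act[OF x g] by simp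
      then show "act X v (ginv G g) \<in> R `` {x}"
        using act_ginv_cancel[OF X x g] by simp
    qed
    then show ?thesis
      using act_rel g by (auto simp: gs_quotient_def)
  qed
qed

lemma gspace_action_gs_quotient:
  assumes X: "gspace_action G X" and R: "gspace_congruence G X R"
  shows "gspace_action G (gs_quotient X R)"
proof -
  interpret gspace_action G X by fact
  have eq: "equiv (topspace (pts X)) R"
    using R by (simp add: gspace_congruence_def)
  have top: "topspace (pts (gs_quotient X R)) = (\<lambda>x. R `` {x}) ` topspace (pts X)"
    by (auto simp: gs_quotient_def topspace_quotient_topology[OF eq] quotient_def)
  show ?thesis
    by standard
      (auto simp: top anchor_gs_quotient[OF X R] act_gs_quotient[OF X R] anchor_in_obj act_in_pts
        anchor_act act_idt act_act)
qed

end

section \<open>Orbit cells and characteristic maps\<close>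

definition orbit_rel :: "('o, 'a) groupoid_data \<Rightarrow> 'o \<Rightarrow> 'a set \<Rightarrow> ('a \<times> 'a) set" where
  "orbit_rel G b H = {(f, gcomp G h f) |f h. f \<in> topspace (pts (target_fibre G b)) \<and> h \<in> H}"

lemma orbit_cell_eq: "orbit_cell G b H = gs_quotient (target_fibre G b) (orbit_rel G b H)"
  by (simp add: orbit_cell_def orbit_rel_def)

lemma topspace_target_fibre:
  "topspace (pts (target_fibre G b)) = {f \<in> topspace (arr G). tgt G f = b}"
  by (auto simp: target_fibre_def)

text \<open>The maps \<open>c\<close> correspond to the equivariant maps from \<open>orbit_cell G b H \<times> K\<close> to \<open>X\<close>.\<close>
definition fixed_map :: "('o, 'a) groupoid_data \<Rightarrow> 'o \<Rightarrow> 'a set \<Rightarrow> 'k topology \<Rightarrow>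
    ('o, 'a, 'x) gspace_data \<Rightarrow> ('k \<Rightarrow> 'x) \<Rightarrow> bool" where
  "fixed_map G b H K X c \<longleftrightarrow> continuous_map K (pts X) c \<and>
     (\<forall>d \<in> topspace K. anchor X (c d) = b \<and> (\<forall>h \<in> H. act X (c d) h = c d))"

lemma fixed_mapD:
  assumes "fixed_map G b H K X c" "d \<in> topspace K"
  shows "c d \<in> topspace (pts X)" "anchor X (c d) = b" "\<And>h. h \<in> H \<Longrightarrow> act X (c d) h = c d"
  using assms continuous_map_image_subset_topspace[of K "pts X" c] by (auto simp: fixed_map_def)

text \<open>On the coset of \<open>f\<close> this is meant to be \<open>act X (c d) f\<close>; the
  choice of \<open>f\<close> does not matter when \<open>c d\<close> is fixed by the
  subgroup.\<close>

definition orbit_extension :: "('o, 'a, 'x) gspace_data \<Rightarrow> ('k \<Rightarrow> 'x) \<Rightarrow> 'a set \<times> 'k \<Rightarrow> 'x" where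
  "orbit_extension X c = (\<lambda>(C, d). the_elem ((\<lambda>f. act X (c d) f) ` C))"

text \<open>An intermediate form of attaching in which no pushout and no topology on
  \<open>Y\<close> occurs: continuous maps of closed cells that biject the open cells with
  \<open>Y - B\<close> as sets. Keeping \<open>K\<close> and \<open>S\<close> arbitrary lets discs
  with their spheres and the zero cells, where \<open>S\<close> and \<open>B\<close> are empty,
  share the same lemmas.\<close>

definition characteristic_maps :: "('o, 'a) groupoid_data \<Rightarrow> 'o \<Rightarrow> 'k topology \<Rightarrow> 'k set \<Rightarrow>
    ('o, 'a, 'x) gspace_data \<Rightarrow> 'x set \<Rightarrow> 'x set \<Rightarrow>
    nat \<Rightarrow> (nat \<Rightarrow> 'a set) \<Rightarrow> (nat \<Rightarrow> 'a set \<times> 'k \<Rightarrow> 'x) \<Rightarrow> bool" where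
  "characteristic_maps G b K S X B Y k H \<Phi> \<longleftrightarrow>
     (\<forall>i<k. closed_isotropy_subgroup G b (H i) \<and>
        equivariant_map G (gs_times (orbit_cell G b (H i)) K) X (\<Phi> i) \<and>
        \<Phi> i ` (topspace (pts (orbit_cell G b (H i))) \<times> S) \<subseteq> B) \<and>
     bij_betw (\<lambda>(i, z). \<Phi> i z)
       (SIGMA i:{..<k}. topspace (pts (orbit_cell G b (H i))) \<times> (topspace K - S)) (Y - B)"

text \<open>Up to replacing \<open>B\<close> and \<open>Y\<close> by their intersections with the fibre over \<open>b\<close>, this refers
  only to that fibre and the isotropy group: both groupoids have the same cells.\<close>
definition isotropy_cells :: "('o, 'a) groupoid_data \<Rightarrow> 'o \<Rightarrow> 'k topology \<Rightarrow> 'k set \<Rightarrow>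
    ('o, 'a, 'x) gspace_data \<Rightarrow> 'x set \<Rightarrow> 'x set \<Rightarrow> bool" where
  "isotropy_cells G b K S X B Y \<longleftrightarrow> (\<exists>(k::nat) H c.
     (\<forall>i<k. closed_isotropy_subgroup G b (H i) \<and> fixed_map G b (H i) K X (c i) \<and>
        c i ` S \<subseteq> B \<and> c i ` (topspace K - S) \<subseteq> Y - B) \<and>
     (\<forall>y \<in> Y - B. anchor X y = b \<longrightarrow>
        (\<exists>i<k. \<exists>d \<in> topspace K - S. \<exists>g \<in> isotropy G b. y = act X (c i d) g)) \<and>
     (\<forall>i<k. \<forall>j<k. \<forall>d \<in> topspace K - S. \<forall>e \<in> topspace K - S. \<forall>g \<in> isotropy G b.
        act X (c i d) g = c j e \<longrightarrow> i = j \<and> d = e \<and> g \<in> H i))"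

text \<open>Collects the consequences of properness and transitivity that are used. The isotropy
  groupoid satisfies them too, so every result below can be applied on both sides of the
  theorem.\<close>

locale compact_transitive_groupoid = topological_groupoid G
  for G :: "('o, 'a) groupoid_data" +
  fixes b :: 'o
  assumes b_in_obj [simp]: "b \<in> topspace (obj G)"
    and compact_arr: "compact_space (arr G)"
    and connected_to_b: "x \<in> topspace (obj G) \<Longrightarrow> \<exists>f \<in> topspace (arr G). tgt G f = b \<and> src G f = x"
begin

lemma closedin_obj_b: "closedin (obj G) {b}"
  using cg_obj by (simp add: cg_space_def Hausdorff_imp_t1_space closedin_t1_singleton)

lemma compact_target_fibre: "compact_space (pts (target_fibre G b))"
proof -
  from closedin_continuous_map_preimage[OF continuous_tgt closedin_obj_b]
  have "closedin (arr G) {f \<in> topspace (arr G). tgt G f = b}"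
    by simp
  then show ?thesis
    using compact_arr by (simp add: target_fibre_def closedin_compact_space compact_space_subtopology)
qed

lemma target_fibre_simps [simp]:
  "anchor (target_fibre G b) = src G" "act (target_fibre G b) = gcomp G"
  by (simp_all add: target_fibre_def)

context
  fixes H assumes H: "closed_isotropy_subgroup G b H"
begin

lemmas H_closed = closed_isotropy_subgroupD[OF b_in_obj H]

lemma H_arr:
  assumes "h \<in> H"
  shows "h \<in> topspace (arr G)" "src G h = b" "tgt G h = b"
  using assms H_closed(1) by (auto simp: isotropy_def)

lemma orbit_rel_iff:
  "(f, f') \<in> orbit_rel G b H \<longleftrightarrow>
    f \<in> topspace (arr G) \<and> tgt G f = b \<and> (\<exists>h\<in>H. f' = gcomp G h f)"
  by (auto simp: orbit_rel_def topspace_target_fibre)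

lemma equiv_orbit_rel: "equiv (topspace (pts (target_fibre G b))) (orbit_rel G b H)"
proof (rule equivI)
  show "orbit_rel G b H \<subseteq> topspace (pts (target_fibre G b)) \<times> topspace (pts (target_fibre G b))"
    by (auto simp: orbit_rel_iff topspace_target_fibre H_arr)
  show "refl_on (topspace (pts (target_fibre G b))) (orbit_rel G b H)"
    using H_closed(2) idt_gcomp
    by (intro refl_onI) (force simp: orbit_rel_iff topspace_target_fibre)
  show "sym (orbit_rel G b H)"
  proof (rule symI)
    fix f f' assume "(f, f') \<in> orbit_rel G b H"
    then obtain h where "f \<in> topspace (arr G)" "tgt G f = b" "h \<in> H" "f' = gcomp G h f"
      by (auto simp: orbit_rel_iff)
    then show "(f', f) \<in> orbit_rel G b H"
      using H_closed(4)[of h] ginv_gcomp_cancel[of h f]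
      by (auto simp: orbit_rel_iff H_arr intro!: bexI[of _ "ginv G h"])
  qed
  show "trans (orbit_rel G b H)"
  proof (rule transI)
    fix f f' f'' assume "(f, f') \<in> orbit_rel G b H" "(f', f'') \<in> orbit_rel G b H"
    then obtain h h' where "f \<in> topspace (arr G)" "tgt G f = b" "h \<in> H" "h' \<in> H"
      "f'' = gcomp G h' (gcomp G h f)"
      by (auto simp: orbit_rel_iff)
    then show "(f, f'') \<in> orbit_rel G b H"
      using H_closed(3)[of h' h]
      by (auto simp: orbit_rel_iff H_arr gcomp_assoc intro!: bexI[of _ "gcomp G h' h"])
  qed
qed

lemma gspace_congruence_orbit_rel: "gspace_congruence G (target_fibre G b) (orbit_rel G b H)"
  unfolding gspace_congruence_def
  using equiv_orbit_rel by (auto simp: orbit_rel_iff H_arr gcomp_assoc) blast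

lemma gspace_action_orbit_cell: "gspace_action G (orbit_cell G b H)"
  unfolding orbit_cell_eq
  by (intro gspace_action_gs_quotient gspace_action_target_fibre gspace_congruence_orbit_rel)

lemma topspace_orbit_cell:
  "topspace (pts (orbit_cell G b H)) =
     (\<lambda>f. orbit_rel G b H `` {f}) ` {f \<in> topspace (arr G). tgt G f = b}"
  by (auto simp: orbit_cell_eq gs_quotient_def topspace_quotient_topology[OF equiv_orbit_rel]
      quotient_def topspace_target_fibre)

lemma quotient_map_orbit_cell:
  "quotient_map (pts (target_fibre G b)) (pts (orbit_cell G b H)) (\<lambda>f. orbit_rel G b H `` {f})"
  using quotient_map_quotient_topology[OF equiv_orbit_rel] by (simp add: orbit_cell_eq gs_quotient_def)

lemma compact_space_orbit_cell: "compact_space (pts (orbit_cell G b H))"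
  using image_compactin[OF _ quotient_imp_continuous_map[OF quotient_map_orbit_cell]]
    compact_target_fibre quotient_imp_surjective_map[OF quotient_map_orbit_cell]
  unfolding compact_space_def by metis

lemma orbit_class_eq_iff:
  assumes "f \<in> topspace (arr G)" "tgt G f = b" "f' \<in> topspace (arr G)" "tgt G f' = b"
  shows "orbit_rel G b H `` {f} = orbit_rel G b H `` {f'} \<longleftrightarrow> (\<exists>h\<in>H. f' = gcomp G h f)"
  using eq_equiv_class_iff[OF equiv_orbit_rel, of f f'] assms
  by (simp add: topspace_target_fibre orbit_rel_iff)

lemma orbit_cell_simps:
  assumes "f \<in> topspace (arr G)" "tgt G f = b"
  shows "anchor (orbit_cell G b H) (orbit_rel G b H `` {f}) = src G f"
    and "\<lbrakk>g \<in> topspace (arr G); src G f = tgt G g\<rbrakk>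
      \<Longrightarrow> act (orbit_cell G b H) (orbit_rel G b H `` {f}) g = orbit_rel G b H `` {gcomp G f g}"
  using anchor_gs_quotient[OF gspace_action_target_fibre gspace_congruence_orbit_rel, of f]
    act_gs_quotient[OF gspace_action_target_fibre gspace_congruence_orbit_rel, of f g] assms
  by (simp_all add: orbit_cell_eq topspace_target_fibre)

text \<open>Well defined since acting by \<open>gcomp G h f\<close> is acting by \<open>h\<close>,
  which fixes \<open>c d\<close>, and then by \<open>f\<close>.\<close>

lemma orbit_extension_class:
  assumes X: "gspace_action G X" and c: "fixed_map G b H K X c"
    and d: "d \<in> topspace K" and f: "f \<in> topspace (arr G)" "tgt G f = b"
  shows "orbit_extension X c (orbit_rel G b H `` {f}, d) = act X (c d) f"
proof -
  interpret X: gspace_action G X by fact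
  have cd: "c d \<in> topspace (pts X)" "anchor X (c d) = b" "\<And>h. h \<in> H \<Longrightarrow> act X (c d) h = c d"
    using fixed_mapD[OF c d] .
  have "act X (c d) u = act X (c d) v" if "(u, v) \<in> orbit_rel G b H" for u v
    using that cd X.act_act[of "c d"] by (auto simp: orbit_rel_iff H_arr) (metis H_arr)
  then show ?thesis
    unfolding orbit_extension_def
    using the_elem_image_class[OF equiv_orbit_rel, of f "act X (c d)"] f
    by (simp add: topspace_target_fibre)
qed

lemma pts_gs_times_orbit_cell:
  assumes "compact_space K"
  shows "pts (gs_times (orbit_cell G b H) K) = prod_topology (pts (orbit_cell G b H)) K"
  by (simp add: gs_times_def cg_prod_compact compact_space_orbit_cell assms)

text \<open>Before dividing by \<open>H\<close> the map sends (f, d) to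
  \<open>act X (c d) f\<close>. This is continuous on the product of the target fibre with
  \<open>K\<close>, which is compact and hence a k-space; continuity then descends along the
  quotient map.\<close>

lemma equivariant_orbit_extension:
  assumes X: "right_gspace G X" and c: "fixed_map G b H K X c"
    and K: "compact_space K" "Hausdorff_space K"
  shows "equivariant_map G (gs_times (orbit_cell G b H) K) X (orbit_extension X c)"
proof -
  interpret X: right_gspace G X by fact
  have act: "gspace_action G X"
    using X by (rule right_gspace_imp_gspace_action)
  note ext = orbit_extension_class[OF act c]
  let ?T = "pts (target_fibre G b)" and ?q = "\<lambda>f. orbit_rel G b H `` {f}"
  have c': "continuous_map K (pts X) c" "\<And>d. d \<in> topspace K \<Longrightarrow> anchor X (c d) = b"
    "\<And>d. d \<in> topspace K \<Longrightarrow> c d \<in> topspace (pts X)"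
    using fixed_mapD[OF c] c by (auto simp: fixed_map_def)
  have "continuous_map (prod_topology ?T K)
      (cg_fibre_prod (pts X) (arr G) (anchor X) (tgt G)) (\<lambda>p. (c (snd p), fst p))"
  proof (rule continuous_map_into_cg_fibre_prod)
    show "k_space (prod_topology ?T K)"
      using compact_target_fibre K(1) by (intro compact_imp_k_space compact_space_prod_topology_intro)
    show "continuous_map (prod_topology ?T K) (pts X) (\<lambda>p. c (snd p))"
      using continuous_map_compose[OF continuous_map_snd c'(1)] by (simp add: o_def)
    have "continuous_map ?T (arr G) id"
      by (simp add: target_fibre_def continuous_map_from_subtopology)
    from continuous_map_compose[OF continuous_map_fst this]
    show "continuous_map (prod_topology ?T K) (arr G) (\<lambda>p. fst p)"
      by (simp add: o_def)
  qed (auto simp: c' topspace_target_fibre)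
  from continuous_map_compose[OF this X.continuous_act]
  have "continuous_map (prod_topology ?T K) (pts X)
      (orbit_extension X c \<circ> (\<lambda>(f, d). (?q f, d)))"
    by (rule continuous_map_eq) (auto simp: topspace_target_fibre ext[symmetric])
  \<comment> \<open>A product of quotient maps need not be a quotient map, but crossing with the
    identity of a compact Hausdorff space preserves quotient maps.\<close>
  moreover have "quotient_map (prod_topology ?T K) (prod_topology (pts (orbit_cell G b H)) K)
      (\<lambda>(f, d). (?q f, d))"
    using K by (intro quotient_map_prod_left quotient_map_orbit_cell)
      (auto intro: compact_imp_locally_compact_space)
  ultimately have "continuous_map (prod_topology (pts (orbit_cell G b H)) K) (pts X) (orbit_extension X c)"
    by (simp add: continuous_compose_quotient_map_eq)
  moreover have "anchor X (act X (c d) f) = src G f"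
    if "f \<in> topspace (arr G)" "tgt G f = b" "d \<in> topspace K" for f d
    using that c' by (simp add: X.anchor_act)
  ultimately show ?thesis
    unfolding equivariant_map_def pts_gs_times_orbit_cell[OF K(1)]
    using c' by (auto simp: gs_times_def topspace_orbit_cell orbit_cell_simps ext X.act_act)
qed

text \<open>A Yoneda argument: the coset of \<open>f\<close> is the unit coset translated by
  \<open>f\<close>, so an equivariant map is determined on the unit coset. Its value there is fixed
  by \<open>H\<close> because \<open>h\<close> in \<open>H\<close> represents the unit
  coset.\<close>

lemma
  assumes X: "gspace_action G X" and K: "compact_space K"
    and \<Phi>: "equivariant_map G (gs_times (orbit_cell G b H) K) X \<Phi>"
  shows fixed_map_of_equivariant_map:
      "fixed_map G b H K X (\<lambda>d. \<Phi> (orbit_rel G b H `` {idt G b}, d))" (is "fixed_map G b H K X ?c")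
    and equivariant_map_class: "\<lbrakk>f \<in> topspace (arr G); tgt G f = b; d \<in> topspace K\<rbrakk>
      \<Longrightarrow> \<Phi> (orbit_rel G b H `` {f}, d) = act X (\<Phi> (orbit_rel G b H `` {idt G b}, d)) f"
proof -
  let ?C = "orbit_rel G b H `` {idt G b}"
  have C: "?C \<in> topspace (pts (orbit_cell G b H))"
    by (auto simp: topspace_orbit_cell)
  have anchor: "anchor (orbit_cell G b H) ?C = b"
    by (simp add: orbit_cell_simps)
  show cls: "\<Phi> (orbit_rel G b H `` {f}, d) = act X (\<Phi> (?C, d)) f"
    if f: "f \<in> topspace (arr G)" "tgt G f = b" and d: "d \<in> topspace K" for f d
  proof -
    have "orbit_rel G b H `` {f} = act (orbit_cell G b H) ?C f"
      using f idt_gcomp[of f] by (simp add: orbit_cell_simps)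
    then show ?thesis
      using \<Phi> C anchor f d
      unfolding equivariant_map_def pts_gs_times_orbit_cell[OF K] by (simp add: gs_times_def)
  qed
  have "continuous_map K (pts X) (\<Phi> \<circ> (\<lambda>d. (?C, d)))"
    using \<Phi> C unfolding equivariant_map_def pts_gs_times_orbit_cell[OF K]
    by (intro continuous_map_compose[where X' = "prod_topology (pts (orbit_cell G b H)) K"])
      (auto intro: continuous_map_pairedI)
  moreover have "anchor X (\<Phi> (?C, d)) = b" if "d \<in> topspace K" for d
    using \<Phi> C anchor that
    unfolding equivariant_map_def pts_gs_times_orbit_cell[OF K] by (simp add: gs_times_def)
  moreover have "act X (\<Phi> (?C, d)) h = \<Phi> (?C, d)" if "d \<in> topspace K" "h \<in> H" for d h
  proof -
    have "orbit_rel G b H `` {h} = ?C"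
      using orbit_class_eq_iff[of "idt G b" h] H_arr[OF that(2)] gcomp_idt[of h] that(2) by force
    then show ?thesis
      using cls[of h d] that by (simp add: H_arr)
  qed
  ultimately show "fixed_map G b H K X ?c"
    by (simp add: fixed_map_def o_def)
qed

end

text \<open>Each \<open>c i\<close> is \<Phi> \<open>i\<close> restricted to the unit coset.
  Bijectivity on open cells is then read off over \<open>b\<close>, where the arrows involved are
  loops.\<close>

lemma isotropy_cells_of_characteristic_maps:
  assumes X: "gspace_action G X" and K: "compact_space K" "S \<subseteq> topspace K"
    and \<Phi>: "characteristic_maps G b K S X B Y k H \<Phi>"
  shows "isotropy_cells G b K S X B Y"
proof -
  let ?q = "\<lambda>i f. orbit_rel G b (H i) `` {f}"
  define c where "c i d = \<Phi> i (?q i (idt G b), d)" for i d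
  have H: "closed_isotropy_subgroup G b (H i)"
    and eqv: "equivariant_map G (gs_times (orbit_cell G b (H i)) K) X (\<Phi> i)"
    and bd: "\<Phi> i ` (topspace (pts (orbit_cell G b (H i))) \<times> S) \<subseteq> B" if "i < k" for i
    using \<Phi> that by (auto simp: characteristic_maps_def)
  have bij: "bij_betw (\<lambda>(i, z). \<Phi> i z)
       (SIGMA i:{..<k}. topspace (pts (orbit_cell G b (H i))) \<times> (topspace K - S)) (Y - B)"
    using \<Phi> by (simp add: characteristic_maps_def)
  have fixed: "fixed_map G b (H i) K X (c i)" if "i < k" for i
    using fixed_map_of_equivariant_map[OF H[OF that] X K(1) eqv[OF that]] by (simp add: c_def[abs_def])
  have cls: "\<Phi> i (?q i f, d) = act X (c i d) f"
    if "i < k" "f \<in> topspace (arr G)" "tgt G f = b" "d \<in> topspace K" for i f d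
    using equivariant_map_class[OF H[OF that(1)] X K(1) eqv[OF that(1)] that(2-)] by (simp add: c_def)
  have q: "?q i f \<in> topspace (pts (orbit_cell G b (H i)))"
    if "i < k" "f \<in> topspace (arr G)" "tgt G f = b" for i f
    using that(2,3) unfolding topspace_orbit_cell[OF H[OF that(1)]] by blast
  have bd': "c i ` S \<subseteq> B" if "i < k" for i
    using bd[OF that] q[OF that, of "idt G b"] by (auto simp: c_def)
  have int: "c i ` (topspace K - S) \<subseteq> Y - B" if "i < k" for i
  proof (rule image_subsetI)
    fix d assume "d \<in> topspace K - S"
    then show "c i d \<in> Y - B"
      using bij_betw_apply[OF bij, of "(i, ?q i (idt G b), d)"] q[OF that, of "idt G b"] that
      by (simp add: c_def)
  qed
  have surj: "\<exists>i<k. \<exists>d \<in> topspace K - S. \<exists>g \<in> isotropy G b. y = act X (c i d) g"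
    if y: "y \<in> Y - B" "anchor X y = b" for y
  proof -
    obtain i C d where "i < k" "C \<in> topspace (pts (orbit_cell G b (H i)))" "d \<in> topspace K - S"
      "y = \<Phi> i (C, d)"
      using y(1) unfolding bij_betw_imp_surj_on[OF bij, symmetric] by auto
    moreover from this obtain f where f: "C = ?q i f" "f \<in> topspace (arr G)" "tgt G f = b"
      using topspace_orbit_cell[OF H] by auto
    ultimately have "y = act X (c i d) f"
      using cls by simp
    \<comment> \<open>The translate of \<open>c i d\<close> by \<open>f\<close> is anchored at the
      source of \<open>f\<close>, so a point over \<open>b\<close> forces \<open>f\<close> to be a
      loop.\<close>
    moreover have "src G f = b"
      using y(2) \<open>y = act X (c i d) f\<close> f fixed_mapD[OF fixed[OF \<open>i < k\<close>], of d]
        \<open>d \<in> topspace K - S\<close> gspace_action.anchor_act[OF X, of "c i d" f]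
      by simp
    ultimately show ?thesis
      using f \<open>i < k\<close> \<open>d \<in> topspace K - S\<close> by (auto simp: isotropy_def)
  qed
  have inj: "i = j \<and> d = e \<and> g \<in> H i"
    if "i < k" "j < k" "d \<in> topspace K - S" "e \<in> topspace K - S" "g \<in> isotropy G b"
      and eq: "act X (c i d) g = c j e" for i j d e g
  proof -
    have g: "g \<in> topspace (arr G)" "tgt G g = b" "src G g = b"
      using that by (auto simp: isotropy_def)
    \<comment> \<open>The coincidence becomes two preimages of one point of an open cell: the coset
      of \<open>g\<close> over \<open>d\<close> and the unit coset over \<open>e\<close>.\<close>
    have "\<Phi> i (?q i g, d) = \<Phi> j (?q j (idt G b), e)"
      using cls[of i g d] eq that g by (simp add: c_def)
    then have "(i, ?q i g, d) = (j, ?q j (idt G b), e)"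
      using q that g
      by (intro inj_onD[OF bij_betw_imp_inj_on[OF bij], of "(i, ?q i g, d)"]) auto
    then have ij: "i = j" "d = e" and "?q i (idt G b) = ?q i g"
      by auto
    then obtain h where "h \<in> H i" "g = gcomp G h (idt G b)"
      using orbit_class_eq_iff[OF H[OF \<open>i < k\<close>], of "idt G b" g] g by auto
    then have "g \<in> H i"
      using gcomp_idt[of h] H_arr[OF H[OF \<open>i < k\<close>], of h] by simp
    with ij show ?thesis
      by simp
  qed
  have 1: "\<forall>i<k. closed_isotropy_subgroup G b (H i) \<and> fixed_map G b (H i) K X (c i) \<and>
        c i ` S \<subseteq> B \<and> c i ` (topspace K - S) \<subseteq> Y - B"
    using H fixed bd' int by simp
  have 2: "\<forall>y \<in> Y - B. anchor X y = b \<longrightarrow>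
      (\<exists>i<k. \<exists>d \<in> topspace K - S. \<exists>g \<in> isotropy G b. y = act X (c i d) g)"
    by (intro ballI impI surj)
  have 3: "\<forall>i<k. \<forall>j<k. \<forall>d \<in> topspace K - S. \<forall>e \<in> topspace K - S. \<forall>g \<in> isotropy G b.
      act X (c i d) g = c j e \<longrightarrow> i = j \<and> d = e \<and> g \<in> H i"
    by (intro allI ballI impI inj)
  show ?thesis
    unfolding isotropy_cells_def
    by (intro exI[of _ k] exI[of _ H] exI[of _ c] conjI 1 2 3)
qed

text \<open>The conditions on \<open>c\<close> speak only of points over \<open>b\<close>. They
  spread to all of \<open>Y - B\<close> because every point can be translated over \<open>b\<close>
  and back, and \<open>B\<close> and \<open>Y\<close> are invariant.\<close>

lemma characteristic_maps_of_isotropy_cells: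
  assumes X: "right_gspace G X" and K: "compact_space K" "Hausdorff_space K" "S \<subseteq> topspace K"
    and B: "invariant_subset G X B" and Y: "invariant_subset G X Y"
    and cells: "isotropy_cells G b K S X B Y"
  shows "\<exists>k H \<Phi>. characteristic_maps G b K S X B Y k H \<Phi>"
proof -
  have act: "gspace_action G X"
    using X by (rule right_gspace_imp_gspace_action)
  interpret X: gspace_action G X by fact
  obtain k :: nat and H c where
    1: "\<forall>i<k. closed_isotropy_subgroup G b (H i) \<and> fixed_map G b (H i) K X (c i) \<and>
        c i ` S \<subseteq> B \<and> c i ` (topspace K - S) \<subseteq> Y - B"
    and surj: "\<forall>y \<in> Y - B. anchor X y = b \<longrightarrow>
        (\<exists>i<k. \<exists>d \<in> topspace K - S. \<exists>g \<in> isotropy G b. y = act X (c i d) g)"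
    and inj: "\<forall>i<k. \<forall>j<k. \<forall>d \<in> topspace K - S. \<forall>e \<in> topspace K - S. \<forall>g \<in> isotropy G b.
        act X (c i d) g = c j e \<longrightarrow> i = j \<and> d = e \<and> g \<in> H i"
    using cells unfolding isotropy_cells_def by (elim exE conjE)
  have H: "closed_isotropy_subgroup G b (H i)" and fixed: "fixed_map G b (H i) K X (c i)"
    and bd: "c i ` S \<subseteq> B" and int: "c i ` (topspace K - S) \<subseteq> Y - B" if "i < k" for i
    using 1 that by blast+
  let ?q = "\<lambda>i f. orbit_rel G b (H i) `` {f}"
  define \<Phi> where "\<Phi> i = orbit_extension X (c i)" for i
  have c: "c i d \<in> topspace (pts X)" "anchor X (c i d) = b" if "i < k" "d \<in> topspace K" for i d
    using fixed_mapD[OF fixed[OF that(1)] that(2)] by blast+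
  have eqv: "equivariant_map G (gs_times (orbit_cell G b (H i)) K) X (\<Phi> i)" if "i < k" for i
    unfolding \<Phi>_def using equivariant_orbit_extension[OF H[OF that] X fixed[OF that] K(1,2)] .
  have cls: "\<Phi> i (?q i f, d) = act X (c i d) f"
    if "i < k" "f \<in> topspace (arr G)" "tgt G f = b" "d \<in> topspace K" for i f d
    unfolding \<Phi>_def using orbit_extension_class[OF H[OF that(1)] act fixed[OF that(1)] that(4,2,3)] .
  \<comment> \<open>Invariance also reflects membership, by translating back with the inverse arrow;
    this is what keeps open cells outside \<open>B\<close>.\<close>
  have inv_iff: "y \<in> A \<longleftrightarrow> act X y g \<in> A" if "invariant_subset G X A" "y \<in> topspace (pts X)"
    "g \<in> topspace (arr G)" "anchor X y = tgt G g" for A y g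
  proof
    assume "act X y g \<in> A"
    then have "act X (act X y g) (ginv G g) \<in> A"
      using that X.anchor_act by (auto simp: invariant_subset_def)
    then show "y \<in> A"
      using act_ginv_cancel[OF act] that by simp
  qed (use that in \<open>auto simp: invariant_subset_def\<close>)
  have "\<Phi> i ` (topspace (pts (orbit_cell G b (H i))) \<times> S) \<subseteq> B" if "i < k" for i
  proof -
    have "act X (c i d) f \<in> B" if "f \<in> topspace (arr G)" "tgt G f = b" "d \<in> S" for f d
      using inv_iff[OF B, of "c i d" f] bd[OF \<open>i < k\<close>] c[OF \<open>i < k\<close>, of d] that K(3) by auto
    then have "\<Phi> i (?q i f, d) \<in> B" if "f \<in> topspace (arr G)" "tgt G f = b" "d \<in> S" for f d
      using cls[OF \<open>i < k\<close> that(1,2), of d] that K(3) by auto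
    then show ?thesis
      unfolding topspace_orbit_cell[OF H[OF that]] by blast
  qed
  moreover have "bij_betw (\<lambda>(i, z). \<Phi> i z)
       (SIGMA i:{..<k}. topspace (pts (orbit_cell G b (H i))) \<times> (topspace K - S)) (Y - B)"
    (is "bij_betw ?\<Phi> ?I _")
  proof (rule bij_betw_imageI)
    have I: "\<exists>i f d. p = (i, ?q i f, d) \<and> i < k \<and> f \<in> topspace (arr G) \<and> tgt G f = b \<and>
        d \<in> topspace K - S \<and> ?\<Phi> p = act X (c i d) f" if "p \<in> ?I" for p
    proof -
      obtain i C d where p: "p = (i, C, d)" "i < k" "C \<in> topspace (pts (orbit_cell G b (H i)))"
        "d \<in> topspace K - S"
        using \<open>p \<in> ?I\<close> by blast
      then obtain f where f: "C = ?q i f" "f \<in> topspace (arr G)" "tgt G f = b"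
        unfolding topspace_orbit_cell[OF H[OF \<open>i < k\<close>]] by blast
      show ?thesis
        using p f cls[of i f d] by (intro exI[of _ i] exI[of _ f] exI[of _ d]) simp
    qed
    show "inj_on ?\<Phi> ?I"
    proof (rule inj_onI)
      fix p p' assume "p \<in> ?I" "p' \<in> ?I" and eq: "?\<Phi> p = ?\<Phi> p'"
      then obtain i f d j f' e where p: "p = (i, ?q i f, d)" "p' = (j, ?q j f', e)"
        and i: "i < k" "f \<in> topspace (arr G)" "tgt G f = b" "d \<in> topspace K - S"
        and j: "j < k" "f' \<in> topspace (arr G)" "tgt G f' = b" "e \<in> topspace K - S"
        and eq: "act X (c i d) f = act X (c j e) f'"
        using I[of p] I[of p'] by metis
      have "src G f = src G f'"
        using X.anchor_act[of "c i d" f] X.anchor_act[of "c j e" f'] eq c i j by simp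
      \<comment> \<open>Cancelling \<open>f'\<close> moves the coincidence over \<open>b\<close>,
        with this loop as the comparing arrow. Once it lies in \<open>H i\<close>, the arrows
        \<open>f\<close> and \<open>f'\<close> represent the same coset.\<close>
      then have g: "gcomp G f (ginv G f') \<in> isotropy G b"
        using i j by (simp add: isotropy_def)
      have "act X (c i d) (gcomp G f (ginv G f')) = act X (act X (c i d) f) (ginv G f')"
        using X.act_act[of "c i d" f "ginv G f'"] c i j \<open>src G f = src G f'\<close> by simp
      also have "\<dots> = c j e"
        using act_ginv_cancel[OF act, of "c j e" f'] c j eq by simp
      finally have "i = j \<and> d = e \<and> gcomp G f (ginv G f') \<in> H i"
        using inj g i j by blast
      moreover have "f = gcomp G (gcomp G f (ginv G f')) f'"
        using gcomp_ginv_cancel_right[of f f'] \<open>src G f = src G f'\<close> i j by simp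
      ultimately show "p = p'"
        using p i j orbit_class_eq_iff[OF H, of i f' f] by auto
    qed
    show "?\<Phi> ` ?I = Y - B"
    proof (rule equalityI)
      show "?\<Phi> ` ?I \<subseteq> Y - B"
      proof (rule image_subsetI)
        fix p assume "p \<in> ?I"
        from I[OF this] obtain i f d where "i < k" "f \<in> topspace (arr G)" "tgt G f = b"
          "d \<in> topspace K - S" "?\<Phi> p = act X (c i d) f"
          by blast
        then show "?\<Phi> p \<in> Y - B"
          using inv_iff[OF B, of "c i d" f] inv_iff[OF Y, of "c i d" f] int[of i] c[of i d] by auto
      qed
      show "Y - B \<subseteq> ?\<Phi> ` ?I"
      proof
        fix y assume y: "y \<in> Y - B"
        then have yX: "y \<in> topspace (pts X)"
          using Y by (auto simp: invariant_subset_def)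
        \<comment> \<open>An arrow from the anchor of \<open>y\<close> to \<open>b\<close>; its
          inverse moves \<open>y\<close> into the fibre, where \<open>surj\<close> applies.\<close>
        obtain f where f: "f \<in> topspace (arr G)" "tgt G f = b" "src G f = anchor X y"
          using connected_to_b X.anchor_in_obj[OF yX] by blast
        have "act X y (ginv G f) \<in> Y - B"
          using inv_iff[OF B yX, of "ginv G f"] inv_iff[OF Y yX, of "ginv G f"] f y by simp
        moreover have "anchor X (act X y (ginv G f)) = b"
          using X.anchor_act[OF yX, of "ginv G f"] f by simp
        ultimately obtain i d g where i: "i < k" "d \<in> topspace K - S" "g \<in> isotropy G b"
          and "act X y (ginv G f) = act X (c i d) g"
          using surj by blast
        then have "y = act X (act X (c i d) g) f"
          using act_ginv_cancel'[OF act yX, of f] f by simp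
        also have "\<dots> = \<Phi> i (?q i (gcomp G g f), d)"
          using i f c[of i d] by (simp add: isotropy_def cls X.act_act)
        finally show "y \<in> ?\<Phi> ` ?I"
          using i f by (intro image_eqI[of _ _ "(i, ?q i (gcomp G g f), d)"])
            (auto simp: topspace_orbit_cell[OF H] isotropy_def)
      qed
    qed
  qed
  ultimately have "characteristic_maps G b K S X B Y k H \<Phi>"
    unfolding characteristic_maps_def using H eqv by blast
  then show ?thesis
    by blast
qed

text \<open>\<open>Y\<close> is the union of \<open>B\<close> and the images of finitely many
  compact closed cells.\<close>

lemma compactin_of_characteristic_maps:
  assumes K: "compact_space K" and \<Phi>: "characteristic_maps G b K S X B Y k H \<Phi>"
    and S: "S \<subseteq> topspace K" and B: "compactin (pts X) B" "B \<subseteq> Y"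
  shows "compactin (pts X) Y"
proof -
  let ?P = "\<lambda>i. topspace (pts (gs_times (orbit_cell G b (H i)) K))"
  have P: "?P i = topspace (pts (orbit_cell G b (H i))) \<times> topspace K" for i
    by (simp add: gs_times_def)
  have bij: "bij_betw (\<lambda>(i, z). \<Phi> i z)
       (SIGMA i:{..<k}. topspace (pts (orbit_cell G b (H i))) \<times> (topspace K - S)) (Y - B)"
    using \<Phi> by (simp add: characteristic_maps_def)
  have "compactin (pts X) (\<Phi> i ` ?P i)" if "i < k" for i
  proof -
    have "compact_space (pts (gs_times (orbit_cell G b (H i)) K))"
      using \<Phi> that K by (simp add: characteristic_maps_def pts_gs_times_orbit_cell
          compact_space_orbit_cell compact_space_prod_topology_intro)
    then show ?thesis
      using \<Phi> that unfolding characteristic_maps_def equivariant_map_def compact_space_def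
      by (blast intro: image_compactin)
  qed
  then have "compactin (pts X) (B \<union> (\<Union>i<k. \<Phi> i ` ?P i))"
    using B(1) by (intro compactin_Un compactin_Union) auto
  moreover have "B \<union> (\<Union>i<k. \<Phi> i ` ?P i) = Y"
  proof
    have "\<Phi> i (C, d) \<in> Y" if "i < k" "C \<in> topspace (pts (orbit_cell G b (H i)))" "d \<in> topspace K"
      for i C d
    proof (cases "d \<in> S")
      case True
      then show ?thesis
        using \<Phi> that B(2) unfolding characteristic_maps_def by blast
    next
      case False
      then show ?thesis
        using bij_betw_apply[OF bij, of "(i, C, d)"] that by simp
    qed
    then show "B \<union> (\<Union>i<k. \<Phi> i ` ?P i) \<subseteq> Y"
      using B(2) unfolding P by blast
    have "Y - B \<subseteq> (\<Union>i<k. \<Phi> i ` ?P i)"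
      unfolding bij_betw_imp_surj_on[OF bij, symmetric] P by auto
    then show "Y \<subseteq> B \<union> (\<Union>i<k. \<Phi> i ` ?P i)"
      by blast
  qed
  ultimately show ?thesis
    by simp
qed

end

section \<open>Attaching cells\<close>

text \<open>A normal form for gluing along an inclusion: a point of \<open>A\<close> moves to its
  image under \<open>f\<close>, and every other point stays.\<close>

definition attach_rep :: "'z set \<Rightarrow> ('z \<Rightarrow> 'y) \<Rightarrow> 'y + 'z \<Rightarrow> 'y + 'z" where
  "attach_rep A f = case_sum Inl (\<lambda>z. if z \<in> A then Inl (f z) else Inr z)"

lemma attach_rep_simps [simp]:
  "attach_rep A f (Inl y) = Inl y"
  "attach_rep A f (Inr z) = (if z \<in> A then Inl (f z) else Inr z)"
  by (simp_all add: attach_rep_def)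

text \<open>Replaces the zigzags of the generated equivalence by a kernel: each point is related to
  its normal form, and the two ends of a generator have the same normal form.\<close>

lemma pushout_rel_eq_kernel:
  "pushout_rel A Y Z f id =
     {(u, v). u \<in> topspace (pts (gs_binary_sum Y Z)) \<and> v \<in> topspace (pts (gs_binary_sum Y Z)) \<and>
        attach_rep (topspace (pts A)) f u = attach_rep (topspace (pts A)) f v}"
proof -
  let ?r = "\<lambda>p q. \<exists>a \<in> topspace (pts A). p = Inl (f a) \<and> q = Inr (id a)"
  let ?\<rho> = "attach_rep (topspace (pts A)) f"
  have rep: "equivclp ?r u (?\<rho> u)" for u
  proof (cases u)
    case (Inr z)
    then show ?thesis
    proof (cases "z \<in> topspace (pts A)")
      case True
      then have "?r (?\<rho> u) u"
        using Inr by auto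
      then show ?thesis
        by (intro equivclp_sym[OF r_into_equivclp])
    qed (simp add: equivp_reflp)
  qed (simp add: equivp_reflp)
  have "equivclp ?r u v \<longleftrightarrow> ?\<rho> u = ?\<rho> v" for u v
  proof
    assume "equivclp ?r u v"
    then show "?\<rho> u = ?\<rho> v"
      by (induction rule: equivclp_induct) auto
  next
    assume "?\<rho> u = ?\<rho> v"
    then have "equivclp ?r v (?\<rho> u)"
      using rep[of v] by simp
    then show "equivclp ?r u v"
      by (rule equivclp_trans[OF rep equivclp_sym])
  qed
  then show ?thesis
    by (simp add: pushout_rel_def)
qed

lemma equivariant_map_gs_sum:
  assumes "\<And>i. i \<in> I \<Longrightarrow> equivariant_map G (X i) Z (f i)"
  shows "equivariant_map G (gs_sum X I) Z (\<lambda>(i, x). f i x)"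
proof -
  have "continuous_map (sum_topology (\<lambda>i. pts (X i)) I) (pts Z) (\<lambda>(i, x). f i x)"
    using assms by (intro continuous_map_from_sum_topology) (simp add: equivariant_map_def)
  then show ?thesis
    using assms by (auto simp: equivariant_map_def gs_sum_def)
qed

lemma equivariant_map_gs_binary_sum:
  assumes "equivariant_map G X Z f" "equivariant_map G Y Z g"
  shows "equivariant_map G (gs_binary_sum X Y) Z (case_sum f g)"
proof -
  have "continuous_map (binary_sum_topology (pts X) (pts Y)) (pts Z) (case_sum f g)"
    using assms by (intro continuous_map_case_sum) (simp_all add: equivariant_map_def)
  then show ?thesis
    using assms
    by (auto simp: equivariant_map_def gs_binary_sum_def topspace_binary_sum_topology)
qed

lemma equivariant_map_in:
  "\<lbrakk>equivariant_map G X Y f; x \<in> topspace (pts X)\<rbrakk> \<Longrightarrow> f x \<in> topspace (pts Y)"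
  using continuous_map_funspace[of "pts X" "pts Y" f] by (auto simp: equivariant_map_def)

text \<open>Passes from a disc to its sphere. Compactness removes the kification on both products,
  after which a product with a subspace is a subspace of the product.\<close>

lemma equivariant_map_gs_times_subtopology:
  assumes f: "equivariant_map G (gs_times X K) Y f"
    and X: "compact_space (pts X)" and K: "compact_space K" and L: "compact_space (subtopology K L)"
  shows "equivariant_map G (gs_times X (subtopology K L)) Y f"
proof -
  have "continuous_map (prod_topology (pts X) K) (pts Y) f"
    using f X K by (simp add: equivariant_map_def gs_times_def cg_prod_compact)
  then have "continuous_map (prod_topology (pts X) (subtopology K L)) (pts Y) f"
    by (simp add: prod_topology_subtopology continuous_map_from_subtopology)
  then show ?thesis
    using f X L by (auto simp: equivariant_map_def gs_times_def cg_prod_compact)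
qed

context topological_groupoid
begin

text \<open>The equivariant form of \<open>homeomorphic_map_quotient_kernel\<close>; it provides the
  identification of the pushout with the next skeleton.\<close>

lemma
  assumes W: "gspace_action G W" and p: "equivariant_map G W Z p"
    and quot: "quotient_map (pts W) (pts Z) p"
    and R: "R = {(u, v). u \<in> topspace (pts W) \<and> v \<in> topspace (pts W) \<and> p u = p v}"
  shows equivariant_homeo_quotient_kernel:
      "equivariant_homeo G (gs_quotient W R) Z (\<lambda>C. the_elem (p ` C))" (is "equivariant_homeo G _ Z ?h")
    and quotient_kernel_class: "u \<in> topspace (pts W) \<Longrightarrow> the_elem (p ` (R `` {u})) = p u"
proof -
  have eq: "equiv (topspace (pts W)) R"
    unfolding R by (rule equiv_kernel)
  have R': "gspace_congruence G W R"
    unfolding R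
    by (rule gspace_congruence_kernel[OF W, where q = "anchor Z" and a = "act Z"])
      (use p in \<open>auto simp: equivariant_map_def\<close>)
  show h: "the_elem (p ` (R `` {u})) = p u" if "u \<in> topspace (pts W)" for u
    by (rule the_elem_image_class[OF eq that]) (simp add: R)
  have top: "topspace (pts (gs_quotient W R)) = (\<lambda>x. R `` {x}) ` topspace (pts W)"
    by (auto simp: gs_quotient_def topspace_quotient_topology[OF eq] quotient_def)
  have homeo: "homeomorphic_map (pts (gs_quotient W R)) (pts Z) ?h"
    using homeomorphic_map_quotient_kernel[OF quot R] by (simp add: gs_quotient_def)
  have "equivariant_map G (gs_quotient W R) Z ?h"
    unfolding equivariant_map_def top
  proof (intro conjI ballI impI)
    show "continuous_map (pts (gs_quotient W R)) (pts Z) ?h"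
      using homeo by (rule homeomorphic_imp_continuous_map)
  next
    fix C assume "C \<in> (\<lambda>x. R `` {x}) ` topspace (pts W)"
    then show "anchor Z (?h C) = anchor (gs_quotient W R) C"
      using p by (auto simp: h anchor_gs_quotient[OF W R'] equivariant_map_def)
  next
    fix C g assume "C \<in> (\<lambda>x. R `` {x}) ` topspace (pts W)" "g \<in> topspace (arr G)"
      "anchor (gs_quotient W R) C = tgt G g"
    then show "?h (act (gs_quotient W R) C g) = act Z (?h C) g"
      using p
      by (auto simp: h anchor_gs_quotient[OF W R'] act_gs_quotient[OF W R'] equivariant_map_def
          gspace_action.act_in_pts[OF W])
  qed
  with homeo show "equivariant_homeo G (gs_quotient W R) Z ?h"
    by (simp add: equivariant_homeo_def)
qed

end

context compact_transitive_groupoid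
begin

text \<open>The characteristic map of a cell is its inclusion into the sum, followed by the
  projection to the pushout and \<theta>. Since \<theta> is the identity on \<open>B\<close>,
  injectivity of \<theta> separates the open cells from \<open>B\<close>.\<close>

lemma characteristic_maps_of_attaches_cells:
  fixes X :: "('o, 'a, 'x) gspace_data"
  assumes X: "right_gspace G X" and B: "invariant_subset G X B" and Y: "invariant_subset G X Y"
    and attaches: "attaches_cells G b n X B Y"
  shows "B \<subseteq> Y"
    and "\<exists>k H \<Phi>. characteristic_maps G b (ndisc (Suc n)) (topspace (nsphere n)) X B Y k H \<Phi>"
proof -
  let ?K = "ndisc (Suc n)" and ?S = "topspace (nsphere n)"
  obtain k :: nat and H and \<phi> :: "nat \<Rightarrow> 'a set \<times> (nat \<Rightarrow> real) \<Rightarrow> 'x" and \<theta> where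
    H\<phi>: "\<forall>i<k. closed_isotropy_subgroup G b (H i) \<and>
        equivariant_map G (gs_times (orbit_cell G b (H i)) (nsphere n)) (gs_sub X B) (\<phi> i)"
    and \<theta>': "equivariant_homeo G (gs_pushout (gs_sum (\<lambda>i. gs_times (orbit_cell G b (H i)) (nsphere n)) {..<k})
        (gs_sub X B) (gs_sum (\<lambda>i. gs_times (orbit_cell G b (H i)) ?K) {..<k})
        (\<lambda>(i, z). \<phi> i z) id) (gs_sub X Y) \<theta>"
    and \<theta>B: "\<forall>x \<in> B. \<theta> (pushout_rel (gs_sum (\<lambda>i. gs_times (orbit_cell G b (H i)) (nsphere n)) {..<k})
        (gs_sub X B) (gs_sum (\<lambda>i. gs_times (orbit_cell G b (H i)) ?K) {..<k})
        (\<lambda>(i, z). \<phi> i z) id `` {Inl x}) = x"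
    using attaches unfolding attaches_cells_def Let_def by (elim exE conjE)
  define A where "A = gs_sum (\<lambda>i. gs_times (orbit_cell G b (H i)) (nsphere n)) {..<k}"
  define D where "D = gs_sum (\<lambda>i. gs_times (orbit_cell G b (H i)) ?K) {..<k}"
  define f where "f = (\<lambda>(i, z). \<phi> i z)"
  define W where "W = gs_binary_sum (gs_sub X B) D"
  define R where "R = pushout_rel A (gs_sub X B) D f id"
  let ?\<rho> = "attach_rep (topspace (pts A)) f"
  let ?cells = "\<lambda>i. topspace (pts (orbit_cell G b (H i)))"
  have H: "closed_isotropy_subgroup G b (H i)" if "i < k" for i
    using H\<phi> that by blast
  have \<theta>: "equivariant_homeo G (gs_quotient W R) (gs_sub X Y) \<theta>"
    using \<theta>' by (simp add: gs_pushout_def A_def D_def f_def W_def R_def)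
  have act: "gspace_action G X"
    using X by (rule right_gspace_imp_gspace_action)
  have BX: "B \<subseteq> topspace (pts X)" and YX: "Y \<subseteq> topspace (pts X)"
    using B Y by (simp_all add: invariant_subset_def)
  have topA: "topspace (pts A) = (SIGMA i:{..<k}. ?cells i \<times> ?S)"
    and topD: "topspace (pts D) = (SIGMA i:{..<k}. ?cells i \<times> topspace ?K)"
    by (auto simp: A_def D_def gs_sum_def gs_times_def)
  have topW: "topspace (pts W) = B <+> topspace (pts D)"
    using BX by (simp add: W_def gs_binary_sum_def gs_sub_def topspace_binary_sum_topology
        inf_absorb2)
  have f: "equivariant_map G A (gs_sub X B) f"
    unfolding A_def f_def using H\<phi> by (intro equivariant_map_gs_sum) auto
  have fB: "f z \<in> B" if "z \<in> topspace (pts A)" for z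
    using f that by (auto simp: equivariant_map_gs_sub)
  have actD: "gspace_action G D"
    unfolding D_def using H
    by (intro gspace_action_gs_sum gspace_action_gs_times gspace_action_orbit_cell) simp
  have actA: "gspace_action G A"
    unfolding A_def using H
    by (intro gspace_action_gs_sum gspace_action_gs_times gspace_action_orbit_cell) simp
  have actW: "gspace_action G W"
    unfolding W_def by (intro gspace_action_gs_binary_sum gspace_action_gs_sub act B actD)
  have AD: "act A = act D" "anchor A = anchor D"
    by (auto simp: A_def D_def gs_sum_def gs_times_def fun_eq_iff)
  \<comment> \<open>The action leaves the disc coordinate alone, so it neither enters nor leaves the
    sphere part.\<close>
  have ADiff: "act D z g \<in> topspace (pts A) \<longleftrightarrow> z \<in> topspace (pts A)"
    if "z \<in> topspace (pts D)" "g \<in> topspace (arr G)" "anchor D z = tgt G g" for z g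
  proof
    assume "z \<in> topspace (pts A)"
    then show "act D z g \<in> topspace (pts A)"
      using gspace_action.act_in_pts[OF actA, of z g] that by (simp add: AD)
  next
    assume "act D z g \<in> topspace (pts A)"
    then show "z \<in> topspace (pts A)"
      using that(1) unfolding topA topD by (auto simp: D_def gs_sum_def gs_times_def)
  qed
  have R: "R = {(u, v). u \<in> topspace (pts W) \<and> v \<in> topspace (pts W) \<and> ?\<rho> u = ?\<rho> v}"
    unfolding R_def W_def by (rule pushout_rel_eq_kernel)
  then have eqR: "equiv (topspace (pts W)) R"
    by (simp only: equiv_kernel)
  have Wsimps: "anchor W (Inl x) = anchor X x" "anchor W (Inr z) = anchor D z"
    "act W (Inl x) g = Inl (act X x g)" "act W (Inr z) g = Inr (act D z g)" for x z g
    by (simp_all add: W_def gs_binary_sum_def gs_sub_def)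
  have fact: "anchor X (f z) = anchor D z"
    "\<lbrakk>g \<in> topspace (arr G); anchor D z = tgt G g\<rbrakk> \<Longrightarrow> f (act D z g) = act X (f z) g"
    if "z \<in> topspace (pts A)" for z g
    using f that by (auto simp: equivariant_map_def gs_sub_def simp flip: AD)
  \<comment> \<open>Normal forms are compatible with anchors and actions, which makes the structure
    of the pushout computable on representatives.\<close>
  have congR: "gspace_congruence G W R"
    unfolding R
  proof (rule gspace_congruence_kernel[OF actW, where q = "anchor W" and a = "act W"])
    fix u assume "u \<in> topspace (pts W)"
    then show "anchor W (?\<rho> u) = anchor W u"
      unfolding topW by (auto simp: Wsimps fact)
  next
    fix u g assume "u \<in> topspace (pts W)" "g \<in> topspace (arr G)" "anchor W u = tgt G g"
    then show "?\<rho> (act W u g) = act W (?\<rho> u) g"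
      unfolding topW by (auto simp: Wsimps fact ADiff)
  qed
  let ?q = "\<lambda>u. R `` {u}"
  have topQ: "topspace (pts (gs_quotient W R)) = ?q ` topspace (pts W)"
    by (auto simp: gs_quotient_def topspace_quotient_topology[OF eqR] quotient_def)
  have topY: "topspace (pts (gs_sub X Y)) = Y"
    using YX by (simp add: gs_sub_def inf_absorb2)
  have homeo: "homeomorphic_map (pts (gs_quotient W R)) (pts (gs_sub X Y)) \<theta>"
    and eqv: "equivariant_map G (gs_quotient W R) (gs_sub X Y) \<theta>"
    using \<theta> by (simp_all add: equivariant_homeo_def)
  have surj: "(\<lambda>u. \<theta> (?q u)) ` topspace (pts W) = Y"
    using homeomorphic_imp_surjective_map[OF homeo] by (simp add: topQ topY image_image)
  have q_eq: "?q u = ?q v \<longleftrightarrow> ?\<rho> u = ?\<rho> v" if "u \<in> topspace (pts W)" "v \<in> topspace (pts W)" for u v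
    using eq_equiv_class_iff[OF eqR that] that by (simp add: R)
  have inj: "\<theta> (?q u) = \<theta> (?q v) \<longleftrightarrow> ?\<rho> u = ?\<rho> v"
    if "u \<in> topspace (pts W)" "v \<in> topspace (pts W)" for u v
    using inj_on_eq_iff[OF homeomorphic_imp_injective_map[OF homeo], of "?q u" "?q v"] that
    by (simp add: topQ q_eq)
  have \<theta>Inl: "\<theta> (?q (Inl x)) = x" if "x \<in> B" for x
    using \<theta>B that by (simp add: A_def D_def f_def R_def)
  have Inl_W: "Inl x \<in> topspace (pts W)" if "x \<in> B" for x
    using that by (auto simp: topW)
  have Inr_W: "Inr z \<in> topspace (pts W)" if "z \<in> topspace (pts D)" for z
    using that by (auto simp: topW)
  have SK: "?S \<subseteq> topspace ?K"
    by (rule topspace_nsphere_subset_ndisc)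
  show "B \<subseteq> Y"
  proof
    fix x assume x: "x \<in> B"
    have "\<theta> (?q (Inl x)) \<in> Y"
      unfolding surj[symmetric] using Inl_W[OF x] by (rule imageI)
    then show "x \<in> Y"
      by (simp only: \<theta>Inl[OF x])
  qed
  define \<Phi> where "\<Phi> i z = \<theta> (?q (Inr (i, z)))" for i z
  have D_iff: "(i, z) \<in> topspace (pts D) \<longleftrightarrow> i < k \<and> z \<in> ?cells i \<times> topspace ?K" for i z
    by (simp add: topD)
  have A_iff: "(i, z) \<in> topspace (pts A) \<longleftrightarrow> i < k \<and> z \<in> ?cells i \<times> ?S" for i z
    by (simp add: topA)
  have bd: "\<Phi> i z \<in> B" if "i < k" "z \<in> ?cells i \<times> ?S" for i z
  proof -
    have z: "(i, z) \<in> topspace (pts A)" "(i, z) \<in> topspace (pts D)"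
      using that SK by (auto simp: D_iff A_iff)
    have "\<theta> (?q (Inr (i, z))) = \<theta> (?q (Inl (f (i, z))))"
      using inj[OF Inr_W Inl_W] z fB by simp
    then show ?thesis
      using \<theta>Inl fB z(1) by (simp add: \<Phi>_def)
  qed
  have "equivariant_map G (gs_times (orbit_cell G b (H i)) ?K) X (\<Phi> i)" if i: "i < k" for i
  proof -
    let ?C = "gs_times (orbit_cell G b (H i)) ?K"
    have topC: "topspace (pts ?C) = ?cells i \<times> topspace ?K"
      by (simp add: gs_times_def)
    have C: "anchor D (i, z) = anchor ?C z" "act D (i, z) g = (i, act ?C z g)" for z g
      by (simp_all add: D_def gs_sum_def)
    have "continuous_map (pts ?C) (pts D) (Pair i)"
      using continuous_map_component_injection[of i "{..<k}" "\<lambda>i. pts (gs_times (orbit_cell G b (H i)) ?K)"] i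
      by (simp add: D_def gs_sum_def)
    from continuous_map_compose[OF this continuous_map_Inr]
    have "continuous_map (pts ?C) (pts W) (\<lambda>z. Inr (i, z))"
      by (simp add: W_def gs_binary_sum_def o_def)
    from continuous_map_compose[OF this quotient_imp_continuous_map[OF quotient_map_quotient_topology[OF eqR]]]
    have "continuous_map (pts ?C) (pts (gs_quotient W R)) (\<lambda>z. ?q (Inr (i, z)))"
      by (simp add: gs_quotient_def o_def)
    from continuous_map_compose[OF this homeomorphic_imp_continuous_map[OF homeo]]
    have "continuous_map (pts ?C) (pts (gs_sub X Y)) (\<Phi> i)"
      by (simp add: \<Phi>_def[abs_def] o_def)
    then have "continuous_map (pts ?C) (pts X) (\<Phi> i)"
      by (simp add: gs_sub_def continuous_map_in_subtopology)
    moreover have "anchor X (\<Phi> i z) = anchor ?C z"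
      and "\<lbrakk>g \<in> topspace (arr G); anchor ?C z = tgt G g\<rbrakk> \<Longrightarrow> \<Phi> i (act ?C z g) = act X (\<Phi> i z) g"
      if "z \<in> topspace (pts ?C)" for z g
    proof -
      have z: "Inr (i, z) \<in> topspace (pts W)"
        using that i by (intro Inr_W) (simp add: D_iff topC)
      note anc = anchor_gs_quotient[OF actW congR z, unfolded Wsimps C]
        and ac = act_gs_quotient[OF actW congR z, unfolded Wsimps C]
      have Q: "?q (Inr (i, z)) \<in> topspace (pts (gs_quotient W R))"
        using z by (simp add: topQ)
      show "anchor X (\<Phi> i z) = anchor ?C z"
        using eqv Q anc by (simp add: \<Phi>_def equivariant_map_def gs_sub_def)
      show "\<Phi> i (act ?C z g) = act X (\<Phi> i z) g"
        if "g \<in> topspace (arr G)" "anchor ?C z = tgt G g"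
        using eqv Q anc that by (simp add: \<Phi>_def equivariant_map_def gs_sub_def flip: ac)
    qed
    ultimately show ?thesis
      by (simp add: equivariant_map_def)
  qed
  moreover have "bij_betw (\<lambda>(i, z). \<Phi> i z) (SIGMA i:{..<k}. ?cells i \<times> (topspace ?K - ?S)) (Y - B)"
    (is "bij_betw ?\<Phi> ?I _")
  proof (rule bij_betw_imageI)
    \<comment> \<open>A point of an open cell is its own normal form, so it is glued to nothing
      else.\<close>
    have I: "Inr p \<in> topspace (pts W)" "?\<rho> (Inr p) = Inr p" "?\<Phi> p = \<theta> (?q (Inr p))" if "p \<in> ?I" for p
      using that by (auto simp: topD topA \<Phi>_def intro!: Inr_W)
    show "inj_on ?\<Phi> ?I"
    proof (rule inj_onI)
      fix p p' assume p: "p \<in> ?I" "p' \<in> ?I" and "?\<Phi> p = ?\<Phi> p'"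
      then have "?\<rho> (Inr p) = ?\<rho> (Inr p')"
        using inj[OF I(1)[OF p(1)] I(1)[OF p(2)]] I(3)[OF p(1)] I(3)[OF p(2)] by argo
      then show "p = p'"
        using I(2)[OF p(1)] I(2)[OF p(2)] by simp
    qed
    show "?\<Phi> ` ?I = Y - B"
    proof (rule equalityI)
      show "?\<Phi> ` ?I \<subseteq> Y - B"
      proof (rule image_subsetI)
        fix p assume p: "p \<in> ?I"
        have "?\<Phi> p \<in> Y"
          unfolding I(3)[OF p] surj[symmetric] using I(1)[OF p] by (rule imageI)
        moreover have "?\<Phi> p \<notin> B"
        proof
          assume x: "?\<Phi> p \<in> B"
          have "\<theta> (?q (Inl (?\<Phi> p))) = \<theta> (?q (Inr p))"
            by (rule trans[OF \<theta>Inl[OF x] I(3)[OF p]])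
          then have "?\<rho> (Inl (?\<Phi> p)) = ?\<rho> (Inr p)"
            using inj[OF Inl_W[OF x] I(1)[OF p]] by blast
          then show False
            using I(2)[OF p] by simp
        qed
        ultimately show "?\<Phi> p \<in> Y - B"
          by blast
      qed
      show "Y - B \<subseteq> ?\<Phi> ` ?I"
      proof
        fix y assume y: "y \<in> Y - B"
        then obtain u where u: "u \<in> topspace (pts W)" "y = \<theta> (?q u)"
          using surj by blast
        then obtain i z where z: "u = Inr (i, z)" "i < k" "z \<in> ?cells i \<times> topspace ?K"
          using y \<theta>Inl by (auto simp: topW topD)
        then have "z \<notin> ?cells i \<times> ?S"
          using bd[of i z] y u by (auto simp: \<Phi>_def)
        then show "y \<in> ?\<Phi> ` ?I"
          using u z by (intro image_eqI[of _ _ "(i, z)"]) (auto simp: \<Phi>_def)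
      qed
    qed
  qed
  ultimately have "characteristic_maps G b ?K ?S X B Y k H \<Phi>"
    unfolding characteristic_maps_def using H bd by blast
  then show "\<exists>k H \<Phi>. characteristic_maps G b ?K ?S X B Y k H \<Phi>"
    by blast
qed

text \<open>The inclusion of \<open>B\<close> and the characteristic maps together give a continuous
  surjection from the compact sum \<open>W\<close> onto the Hausdorff space \<open>Y\<close>, hence
  a quotient map. It remains to see that its kernel is the pushout relation.\<close>

lemma attaches_cells_of_characteristic_maps:
  assumes X: "right_gspace G X" and B: "invariant_subset G X B" and Y: "invariant_subset G X Y"
    and compact: "compactin (pts X) B" and BY: "B \<subseteq> Y"
    and \<Phi>: "characteristic_maps G b (ndisc (Suc n)) (topspace (nsphere n)) X B Y k H \<Phi>"
  shows "attaches_cells G b n X B Y"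
proof -
  let ?K = "ndisc (Suc n)" and ?S = "topspace (nsphere n)"
  let ?cells = "\<lambda>i. topspace (pts (orbit_cell G b (H i)))"
  define A where "A = gs_sum (\<lambda>i. gs_times (orbit_cell G b (H i)) (nsphere n)) {..<k}"
  define D where "D = gs_sum (\<lambda>i. gs_times (orbit_cell G b (H i)) ?K) {..<k}"
  define f where "f = (\<lambda>(i, z). \<Phi> i z)"
  define W where "W = gs_binary_sum (gs_sub X B) D"
  define R where "R = pushout_rel A (gs_sub X B) D f id"
  let ?\<rho> = "attach_rep (topspace (pts A)) f"
  have H: "closed_isotropy_subgroup G b (H i)"
    and eqv: "equivariant_map G (gs_times (orbit_cell G b (H i)) ?K) X (\<Phi> i)"
    and bd: "\<Phi> i ` (?cells i \<times> ?S) \<subseteq> B" if "i < k" for i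
    using \<Phi> that unfolding characteristic_maps_def by blast+
  have bij: "bij_betw f (SIGMA i:{..<k}. ?cells i \<times> (topspace ?K - ?S)) (Y - B)"
    using \<Phi> by (simp add: characteristic_maps_def f_def)
  have act: "gspace_action G X"
    using X by (rule right_gspace_imp_gspace_action)
  have BX: "B \<subseteq> topspace (pts X)" and YX: "Y \<subseteq> topspace (pts X)"
    using B Y by (simp_all add: invariant_subset_def)
  have SK: "?S \<subseteq> topspace ?K"
    by (rule topspace_nsphere_subset_ndisc)
  have topA: "topspace (pts A) = (SIGMA i:{..<k}. ?cells i \<times> ?S)"
    and topD: "topspace (pts D) = (SIGMA i:{..<k}. ?cells i \<times> topspace ?K)"
    by (auto simp: A_def D_def gs_sum_def gs_times_def)
  have topW: "topspace (pts W) = B <+> topspace (pts D)"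
    using BX by (simp add: W_def gs_binary_sum_def gs_sub_def topspace_binary_sum_topology
        inf_absorb2)
  have topY: "topspace (pts (gs_sub X Y)) = Y"
    using YX by (simp add: gs_sub_def inf_absorb2)
  have sphere: "equivariant_map G (gs_times (orbit_cell G b (H i)) (nsphere n)) (gs_sub X B) (\<Phi> i)"
    if "i < k" for i
    unfolding equivariant_map_gs_sub
  proof
    show "equivariant_map G (gs_times (orbit_cell G b (H i)) (nsphere n)) X (\<Phi> i)"
      using equivariant_map_gs_times_subtopology[OF eqv[OF that] compact_space_orbit_cell[OF H[OF that]]
          compact_space_ndisc, of ?S] compact_space_nsphere[of n]
      by (simp only: nsphere_eq_subtopology_ndisc[symmetric])
    show "\<Phi> i ` topspace (pts (gs_times (orbit_cell G b (H i)) (nsphere n))) \<subseteq> B"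
      using bd[OF that] by (simp add: gs_times_def)
  qed
  have fA: "f z \<in> B" if "z \<in> topspace (pts A)" for z
    using that bd unfolding topA by (auto simp: f_def)
  have fI: "f z \<in> Y - B" if "z \<in> topspace (pts D) - topspace (pts A)" for z
    using that by (intro bij_betw_apply[OF bij]) (auto simp: topA topD)
  have fD: "equivariant_map G D (gs_sub X Y) f"
    unfolding equivariant_map_gs_sub
  proof
    show "equivariant_map G D X f"
      unfolding D_def f_def using eqv by (intro equivariant_map_gs_sum) auto
    show "f ` topspace (pts D) \<subseteq> Y"
      using fA fI BY by blast
  qed
  let ?\<psi> = "case_sum id f"
  have incl: "equivariant_map G (gs_sub X B) (gs_sub X Y) id"
    using BY unfolding equivariant_map_gs_sub
    by (auto simp: equivariant_map_def gs_sub_def continuous_map_from_subtopology)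
  have \<psi>: "equivariant_map G W (gs_sub X Y) ?\<psi>"
    unfolding W_def using incl fD by (rule equivariant_map_gs_binary_sum)
  have actW: "gspace_action G W"
    unfolding W_def D_def using H
    by (intro gspace_action_gs_binary_sum gspace_action_gs_sub act B
        gspace_action_gs_sum gspace_action_gs_times gspace_action_orbit_cell) simp
  have "?\<psi> ` topspace (pts W) = Y"
  proof
    show "?\<psi> ` topspace (pts W) \<subseteq> Y"
      using equivariant_map_in[OF \<psi>] topY by blast
    have "Y - B \<subseteq> f ` topspace (pts D)"
      unfolding bij_betw_imp_surj_on[OF bij, symmetric] topD by (intro image_mono) auto
    then show "Y \<subseteq> ?\<psi> ` topspace (pts W)"
      unfolding topW by (force simp: image_iff)
  qed
  moreover have "compact_space (pts W)"
  proof -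
    have "compact_space (pts (gs_times (orbit_cell G b (H i)) ?K))" if "i < k" for i
      using H[OF that] by (simp add: pts_gs_times_orbit_cell compact_space_ndisc
          compact_space_orbit_cell compact_space_prod_topology_intro)
    then have "compact_space (pts D)"
      unfolding D_def gs_sum_def gspace_data.simps
      by (intro compact_space_sum_topology) simp_all
    moreover have "compact_space (pts (gs_sub X B))"
      using compact by (simp add: gs_sub_def compact_space_subtopology)
    ultimately show ?thesis
      by (simp add: W_def gs_binary_sum_def compact_space_binary_sum)
  qed
  moreover have "Hausdorff_space (pts (gs_sub X Y))"
    using X by (simp add: gs_sub_def Hausdorff_space_subtopology right_gspace_def cg_space_def)
  ultimately have quot: "quotient_map (pts W) (pts (gs_sub X Y)) ?\<psi>"
    using \<psi> by (intro continuous_closed_imp_quotient_map T1_Spaces.continuous_imp_closed_map)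
      (auto simp: equivariant_map_def topY)
  \<comment> \<open>A point and its normal form have the same image, and on normal forms the map is
    injective because open cells biject with \<open>Y - B\<close> and so miss \<open>B\<close>.
    Hence both functions have the same kernel.\<close>
  have rep: "\<exists>w \<in> B <+> (topspace (pts D) - topspace (pts A)). ?\<rho> u = w \<and> ?\<psi> u = ?\<psi> w"
    if "u \<in> topspace (pts W)" for u
    using that fA unfolding topW by auto
  have inj: "w = w'"
    if "w \<in> B <+> (topspace (pts D) - topspace (pts A))" "w' \<in> B <+> (topspace (pts D) - topspace (pts A))"
      "?\<psi> w = ?\<psi> w'" for w w'
  proof -
    have "inj_on f (topspace (pts D) - topspace (pts A))"
      using bij_betw_imp_inj_on[OF bij] by (rule inj_on_subset) (auto simp: topA topD)
    then show ?thesis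
      using that fI by (auto dest: inj_onD)
  qed
  have "?\<rho> u = ?\<rho> v \<longleftrightarrow> ?\<psi> u = ?\<psi> v" if "u \<in> topspace (pts W)" "v \<in> topspace (pts W)" for u v
    using rep[OF that(1)] rep[OF that(2)] inj by metis
  then have R: "R = {(u, v). u \<in> topspace (pts W) \<and> v \<in> topspace (pts W) \<and> ?\<psi> u = ?\<psi> v}"
    unfolding R_def pushout_rel_eq_kernel by (auto simp: W_def)
  have "equivariant_homeo G (gs_quotient W R) (gs_sub X Y) (\<lambda>C. the_elem (?\<psi> ` C))"
    by (rule equivariant_homeo_quotient_kernel[OF actW \<psi> quot R])
  moreover have "the_elem (?\<psi> ` (R `` {Inl x})) = x" if "x \<in> B" for x
    using quotient_kernel_class[OF actW \<psi> quot R, of "Inl x"] that by (simp add: topW InlI)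
  ultimately have "\<exists>\<theta>. equivariant_homeo G (gs_pushout A (gs_sub X B) D f id) (gs_sub X Y) \<theta> \<and>
      (\<forall>x \<in> B. \<theta> (pushout_rel A (gs_sub X B) D f id `` {Inl x}) = x)"
    unfolding gs_pushout_def W_def[symmetric] R_def[symmetric] by blast
  then show ?thesis
    unfolding attaches_cells_def Let_def A_def D_def f_def using H sphere by blast
qed

text \<open>\<open>ndisc 0\<close> is the single point \<open>?o\<close>, so zero cells are cells
  with empty boundary attached to the empty set. The missing homeomorphism comes from a continuous
  bijection of a compact space onto a Hausdorff space.\<close>

lemma zero_cells_iff_characteristic_maps:
  assumes X: "right_gspace G X" and Y: "invariant_subset G X Y"
  shows "(\<exists>(k::nat) H \<theta>. (\<forall>i<k. closed_isotropy_subgroup G b (H i)) \<and>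
      equivariant_homeo G (gs_sum (\<lambda>i. orbit_cell G b (H i)) {..<k}) (gs_sub X Y) \<theta>) \<longleftrightarrow>
    (\<exists>k H \<Phi>. characteristic_maps G b (ndisc 0) {} X {} Y k H \<Phi>)" (is "?L \<longleftrightarrow> ?R")
proof -
  let ?o = "(\<lambda>_. 0) :: nat \<Rightarrow> real"
  have top0: "topspace (ndisc 0) = {?o}"
    by (auto simp: ndisc_def topspace_Euclidean_space)
  have YX: "Y \<subseteq> topspace (pts X)"
    using Y by (simp add: invariant_subset_def)
  have topY: "topspace (pts (gs_sub X Y)) = Y"
    using YX by (simp add: gs_sub_def inf_absorb2)
  have topsum: "topspace (pts (gs_sum (\<lambda>i. orbit_cell G b (H i)) {..<k})) =
      (SIGMA i:{..<k}. topspace (pts (orbit_cell G b (H i))))" for H and k :: nat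
    by (auto simp: gs_sum_def)
  have pts: "pts (gs_times (orbit_cell G b H) (ndisc 0)) = prod_topology (pts (orbit_cell G b H)) (ndisc 0)"
    if "closed_isotropy_subgroup G b H" for H
    by (rule pts_gs_times_orbit_cell[OF that compact_space_ndisc])
  show ?thesis
  proof
    assume ?L
    then obtain k :: nat and H \<theta> where H: "\<forall>i<k. closed_isotropy_subgroup G b (H i)"
      and \<theta>: "homeomorphic_map (pts (gs_sum (\<lambda>i. orbit_cell G b (H i)) {..<k})) (pts (gs_sub X Y)) \<theta>"
      "equivariant_map G (gs_sum (\<lambda>i. orbit_cell G b (H i)) {..<k}) (gs_sub X Y) \<theta>"
      unfolding equivariant_homeo_def by blast
    define \<Phi> where "\<Phi> i = \<theta> \<circ> (\<lambda>(C, d::nat \<Rightarrow> real). (i, C))" for i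
    have "equivariant_map G (gs_times (orbit_cell G b (H i)) (ndisc 0)) X (\<Phi> i)" if "i < k" for i
    proof -
      have "equivariant_map G (gs_times (orbit_cell G b (H i)) (ndisc 0))
          (gs_sum (\<lambda>i. orbit_cell G b (H i)) {..<k}) (\<lambda>(C, d). (i, C))"
      proof -
        have "continuous_map (prod_topology (pts (orbit_cell G b (H i))) (ndisc 0))
          (sum_topology (\<lambda>i. pts (orbit_cell G b (H i))) {..<k}) (Pair i \<circ> fst)"
          using that by (intro continuous_map_compose[OF continuous_map_fst]
              continuous_map_component_injection) simp
        then have "continuous_map (pts (gs_times (orbit_cell G b (H i)) (ndisc 0)))
          (pts (gs_sum (\<lambda>i. orbit_cell G b (H i)) {..<k})) (\<lambda>(C, d). (i, C))"
          using H that by (simp add: pts gs_sum_def o_def case_prod_beta')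
        then show ?thesis
          unfolding equivariant_map_def by (auto simp: gs_sum_def gs_times_def)
      qed
      from equivariant_map_compose[OF this \<theta>(2)] show ?thesis
        by (simp add: \<Phi>_def equivariant_map_gs_sub)
    qed
    moreover have "bij_betw (\<lambda>(i, z). \<Phi> i z)
        (SIGMA i:{..<k}. topspace (pts (orbit_cell G b (H i))) \<times> (topspace (ndisc 0) - {})) (Y - {})"
    proof -
      have "bij_betw \<theta> (SIGMA i:{..<k}. topspace (pts (orbit_cell G b (H i)))) Y"
        using homeomorphic_imp_surjective_map[OF \<theta>(1)] homeomorphic_imp_injective_map[OF \<theta>(1)]
        by (simp only: topsum topY bij_betw_def)
      moreover have "bij_betw (\<lambda>(i, C, d). (i, C))
          (SIGMA i:{..<k}. topspace (pts (orbit_cell G b (H i))) \<times> {?o})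
          (SIGMA i:{..<k}. topspace (pts (orbit_cell G b (H i))))"
        by (rule bij_betwI[of _ _ _ "\<lambda>(i, C). (i, C, ?o)"]) auto
      ultimately have "bij_betw (\<theta> \<circ> (\<lambda>(i, C, d). (i, C)))
          (SIGMA i:{..<k}. topspace (pts (orbit_cell G b (H i))) \<times> {?o}) Y"
        by (rule bij_betw_trans[rotated])
      then show ?thesis
        by (simp add: top0 \<Phi>_def o_def case_prod_beta')
    qed
    ultimately have "characteristic_maps G b (ndisc 0) {} X {} Y k H \<Phi>"
      using H by (simp add: characteristic_maps_def)
    then show ?R
      by blast
  next
    assume ?R
    then obtain k H \<Phi> where char: "characteristic_maps G b (ndisc 0) {} X {} Y k H \<Phi>"
      by blast
    have H: "closed_isotropy_subgroup G b (H i)"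
      and \<Phi>: "equivariant_map G (gs_times (orbit_cell G b (H i)) (ndisc 0)) X (\<Phi> i)" if "i < k" for i
      using char that by (simp_all add: characteristic_maps_def)
    have bij: "bij_betw (\<lambda>(i, z). \<Phi> i z)
        (SIGMA i:{..<k}. topspace (pts (orbit_cell G b (H i))) \<times> {?o}) Y"
      using char by (simp add: characteristic_maps_def top0)
    define \<theta> where "\<theta> = (\<lambda>(i, C). (\<Phi> i \<circ> (\<lambda>C. (C, ?o))) C)"
    have "bij_betw (\<lambda>(i, C). (i, C, ?o)) (SIGMA i:{..<k}. topspace (pts (orbit_cell G b (H i))))
        (SIGMA i:{..<k}. topspace (pts (orbit_cell G b (H i))) \<times> {?o})"
      by (rule bij_betwI[of _ _ _ "\<lambda>(i, C, d). (i, C)"]) auto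
    from bij_betw_trans[OF this bij]
    have bij\<theta>: "bij_betw \<theta> (SIGMA i:{..<k}. topspace (pts (orbit_cell G b (H i)))) Y"
      by (simp add: \<theta>_def o_def case_prod_beta')
    have "equivariant_map G (gs_sum (\<lambda>i. orbit_cell G b (H i)) {..<k}) X \<theta>"
      unfolding \<theta>_def
    proof (intro equivariant_map_gs_sum equivariant_map_compose[OF _ \<Phi>])
      fix i assume "i \<in> {..<k}"
      then have "continuous_map (pts (orbit_cell G b (H i)))
          (pts (gs_times (orbit_cell G b (H i)) (ndisc 0))) (\<lambda>C. (C, ?o))"
        using H by (simp add: pts continuous_map_pairedI top0)
      then show "equivariant_map G (orbit_cell G b (H i)) (gs_times (orbit_cell G b (H i)) (ndisc 0))
          (\<lambda>C. (C, ?o))"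
        by (simp add: equivariant_map_def gs_times_def)
    qed simp
    then have eqv: "equivariant_map G (gs_sum (\<lambda>i. orbit_cell G b (H i)) {..<k}) (gs_sub X Y) \<theta>"
      using bij_betw_imp_surj_on[OF bij\<theta>] by (simp add: equivariant_map_gs_sub topsum)
    moreover have "homeomorphic_map (pts (gs_sum (\<lambda>i. orbit_cell G b (H i)) {..<k})) (pts (gs_sub X Y)) \<theta>"
    proof (rule continuous_imp_homeomorphic_map)
      show "compact_space (pts (gs_sum (\<lambda>i. orbit_cell G b (H i)) {..<k}))"
        unfolding gs_sum_def gspace_data.simps using H
        by (intro compact_space_sum_topology compact_space_orbit_cell) auto
      show "Hausdorff_space (pts (gs_sub X Y))"
        using X by (simp add: gs_sub_def Hausdorff_space_subtopology right_gspace_def cg_space_def)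
      show "\<theta> ` topspace (pts (gs_sum (\<lambda>i. orbit_cell G b (H i)) {..<k})) = topspace (pts (gs_sub X Y))"
        using bij_betw_imp_surj_on[OF bij\<theta>] by (simp only: topsum topY)
      show "inj_on \<theta> (topspace (pts (gs_sum (\<lambda>i. orbit_cell G b (H i)) {..<k})))"
        using bij_betw_imp_inj_on[OF bij\<theta>] by (simp only: topsum)
    qed (use eqv in \<open>simp add: equivariant_map_def\<close>)
    ultimately show ?L
      using H unfolding equivariant_homeo_def by blast
  qed
qed

end

section \<open>Filtrations by cells and restriction to the isotropy group\<close>

text \<open>Monotonicity is demanded separately: \<open>isotropy_cells\<close> sees \<open>Y\<close>
  only through \<open>Y - B\<close> and does not force \<open>B\<close> into
  \<open>Y\<close>.\<close>

definition cell_filtration :: "('o, 'a) groupoid_data \<Rightarrow> 'o \<Rightarrow> ('o, 'a, 'x) gspace_data \<Rightarrow>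
    (nat \<Rightarrow> 'x set) \<Rightarrow> bool" where
  "cell_filtration G b X Sk \<longleftrightarrow>
     (\<forall>n. invariant_subset G X (Sk n)) \<and> (\<forall>n. Sk n \<subseteq> Sk (Suc n)) \<and>
     (\<Union>n. Sk n) = topspace (pts X) \<and>
     (\<forall>C \<subseteq> topspace (pts X).
        (\<forall>n. closedin (subtopology (pts X) (Sk n)) (C \<inter> Sk n)) \<longrightarrow> closedin (pts X) C) \<and>
     isotropy_cells G b (ndisc 0) {} X {} (Sk 0) \<and>
     (\<forall>n. isotropy_cells G b (ndisc (Suc n)) (topspace (nsphere n)) X (Sk n) (Sk (Suc n)))"

context compact_transitive_groupoid
begin

lemma isotropy_cells_iff_characteristic_maps:
  assumes "right_gspace G X" "compact_space K" "Hausdorff_space K" "S \<subseteq> topspace K"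
    and "invariant_subset G X B" "invariant_subset G X Y"
  shows "isotropy_cells G b K S X B Y \<longleftrightarrow> (\<exists>k H \<Phi>. characteristic_maps G b K S X B Y k H \<Phi>)"
  using characteristic_maps_of_isotropy_cells[OF assms]
    isotropy_cells_of_characteristic_maps[OF right_gspace_imp_gspace_action[OF assms(1)] assms(2,4)]
  by blast

lemma zero_cells_iff:
  assumes X: "right_gspace G X" and Y: "invariant_subset G X Y"
  shows "(\<exists>(k::nat) H \<theta>. (\<forall>i<k. closed_isotropy_subgroup G b (H i)) \<and>
      equivariant_homeo G (gs_sum (\<lambda>i. orbit_cell G b (H i)) {..<k}) (gs_sub X Y) \<theta>) \<longleftrightarrow>
    isotropy_cells G b (ndisc 0) {} X {} Y"
  unfolding zero_cells_iff_characteristic_maps[OF assms]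
  by (rule isotropy_cells_iff_characteristic_maps[OF X compact_space_ndisc Hausdorff_space_ndisc _ _ Y,
      symmetric]) (simp_all add: invariant_subset_def)

lemma compactin_of_isotropy_cells:
  assumes X: "right_gspace G X" and K: "compact_space K" "Hausdorff_space K" "S \<subseteq> topspace K"
    and inv: "invariant_subset G X B" "invariant_subset G X Y"
    and cells: "isotropy_cells G b K S X B Y" and B: "compactin (pts X) B" "B \<subseteq> Y"
  shows "compactin (pts X) Y"
  using cells compactin_of_characteristic_maps[OF K(1) _ K(3) B]
  unfolding isotropy_cells_iff_characteristic_maps[OF X K inv] by blast

lemma attaches_cells_iff:
  assumes X: "right_gspace G X" and B: "invariant_subset G X B" and Y: "invariant_subset G X Y"
    and compact: "compactin (pts X) B"
  shows "attaches_cells G b n X B Y \<longleftrightarrow>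
    B \<subseteq> Y \<and> isotropy_cells G b (ndisc (Suc n)) (topspace (nsphere n)) X B Y"
  unfolding isotropy_cells_iff_characteristic_maps[OF X compact_space_ndisc Hausdorff_space_ndisc
      topspace_nsphere_subset_ndisc B Y]
  using characteristic_maps_of_attaches_cells[OF X B Y]
    attaches_cells_of_characteristic_maps[OF X B Y compact] by blast

text \<open>The step hypothesis may assume that the current skeleton is compact, because
  \<open>attaches_cells_iff\<close> asks for it. The induction thus supplies its own
  precondition.\<close>

lemma compactin_filtration:
  assumes X: "right_gspace G X" and inv: "\<And>n. invariant_subset G X (Sk n)"
    and zero: "isotropy_cells G b (ndisc 0) {} X {} (Sk 0)"
    and step: "\<And>n. compactin (pts X) (Sk n) \<Longrightarrow> Sk n \<subseteq> Sk (Suc n) \<and>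
      isotropy_cells G b (ndisc (Suc n)) (topspace (nsphere n)) X (Sk n) (Sk (Suc n))"
  shows "compactin (pts X) (Sk n)"
proof (induction n)
  case 0
  have "invariant_subset G X {}"
    by (simp add: invariant_subset_def)
  then show ?case
    using compactin_of_isotropy_cells[OF X compact_space_ndisc Hausdorff_space_ndisc _ _ inv zero]
    by simp
next
  case (Suc n)
  show ?case
    using compactin_of_isotropy_cells[OF X compact_space_ndisc Hausdorff_space_ndisc
        topspace_nsphere_subset_ndisc inv inv conjunct2[OF step[OF Suc]] Suc conjunct1[OF step[OF Suc]]] .
qed

lemma compactin_cell_filtration:
  assumes X: "right_gspace G X" and Sk: "cell_filtration G b X Sk"
  shows "compactin (pts X) (Sk n)"
  using Sk unfolding cell_filtration_def by (intro compactin_filtration[OF X]) auto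

lemma G_CW_complex_iff_cell_filtration:
  assumes X: "right_gspace G X"
  shows "G_CW_complex G b X \<longleftrightarrow> (\<exists>Sk. cell_filtration G b X Sk)"
proof -
  let ?cells = "\<lambda>Sk n. isotropy_cells G b (ndisc (Suc n)) (topspace (nsphere n)) X (Sk n) (Sk (Suc n))"
  \<comment> \<open>The levelwise equivalence needs compact skeleta, so compactness is first derived
    from whichever description is given.\<close>
  have attaches: "(\<forall>n. attaches_cells G b n X (Sk n) (Sk (Suc n))) \<longleftrightarrow>
      (\<forall>n. Sk n \<subseteq> Sk (Suc n)) \<and> (\<forall>n. ?cells Sk n)"
    if inv: "\<forall>n. invariant_subset G X (Sk n)"
      and zero: "isotropy_cells G b (ndisc 0) {} X {} (Sk 0)" for Sk
  proof -
    have iff: "attaches_cells G b n X (Sk n) (Sk (Suc n)) \<longleftrightarrow> Sk n \<subseteq> Sk (Suc n) \<and> ?cells Sk n"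
      if "compactin (pts X) (Sk n)" for n
      using attaches_cells_iff[OF X _ _ that] inv by blast
    show ?thesis
    proof
      assume attaches: "\<forall>n. attaches_cells G b n X (Sk n) (Sk (Suc n))"
      have "compactin (pts X) (Sk n)" for n
        using inv zero iff attaches by (intro compactin_filtration[OF X]) blast+
      then show "(\<forall>n. Sk n \<subseteq> Sk (Suc n)) \<and> (\<forall>n. ?cells Sk n)"
        using iff attaches by blast
    next
      assume cells: "(\<forall>n. Sk n \<subseteq> Sk (Suc n)) \<and> (\<forall>n. ?cells Sk n)"
      have "compactin (pts X) (Sk n)" for n
        using inv zero cells by (intro compactin_filtration[OF X]) blast+
      then show "\<forall>n. attaches_cells G b n X (Sk n) (Sk (Suc n))"
        using iff cells by blast
    qed
  qed
  have "(\<forall>n. invariant_subset G X (Sk n)) \<and> (\<Union>n. Sk n) = topspace (pts X) \<and>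
        (\<forall>U \<subseteq> topspace (pts X).
           openin (pts X) U \<longleftrightarrow> (\<forall>n. openin (subtopology (pts X) (Sk n)) (U \<inter> Sk n))) \<and>
        (\<exists>(k::nat) H \<theta>. (\<forall>i<k. closed_isotropy_subgroup G b (H i)) \<and>
           equivariant_homeo G (gs_sum (\<lambda>i. orbit_cell G b (H i)) {..<k}) (gs_sub X (Sk 0)) \<theta>) \<and>
        (\<forall>n. attaches_cells G b n X (Sk n) (Sk (Suc n))) \<longleftrightarrow> cell_filtration G b X Sk"
    (is "?inv \<and> ?Un \<and> ?open \<and> ?zero \<and> ?attaches \<longleftrightarrow> _") for Sk
  proof -
    let ?closed = "\<forall>C \<subseteq> topspace (pts X).
        (\<forall>n. closedin (subtopology (pts X) (Sk n)) (C \<inter> Sk n)) \<longrightarrow> closedin (pts X) C"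
    have "?Un \<Longrightarrow> ?open \<longleftrightarrow> ?closed"
      by (rule openin_union_iff_closedin_union)
    moreover have "?inv \<Longrightarrow> ?zero \<longleftrightarrow> isotropy_cells G b (ndisc 0) {} X {} (Sk 0)"
      by (rule zero_cells_iff[OF X]) blast
    ultimately show ?thesis
      unfolding cell_filtration_def using attaches[of Sk] by argo
  qed
  then show ?thesis
    using X unfolding G_CW_complex_def by simp
qed

end

section \<open>Compactness from properness and transitivity\<close>

lemma compact_transitive_groupoid_of_proper_target:
  assumes G: "topological_groupoid G" "transitive_groupoid G" "proper_target G"
    and b: "b \<in> topspace (obj G)"
  shows "compact_transitive_groupoid G b"
proof -
  interpret topological_groupoid G by fact
  let ?E = "{(src G g, tgt G g) |g. g \<in> topspace (arr G)}"
  obtain A where "topspace (obj G) // ?E = {A}"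
    using G(2) by (auto simp: transitive_groupoid_def orbit_space_def is_singleton_def)
  \<comment> \<open>All objects have the same image \<open>A\<close> under the relation. The
    identity at \<open>b\<close> puts \<open>b\<close> into it, so every \<open>x\<close> has an
    arrow to \<open>b\<close>.\<close>
  then have E: "?E `` {x} = A" if "x \<in> topspace (obj G)" for x
    using quotientI[OF that, of ?E] by simp
  have conn: "\<exists>f \<in> topspace (arr G). tgt G f = b \<and> src G f = x" if x: "x \<in> topspace (obj G)" for x
  proof -
    have "b \<in> ?E `` {b}"
      using b by (auto intro!: exI[of _ "idt G b"])
    then have "b \<in> ?E `` {x}"
      using E[OF b] E[OF x] by blast
    then show ?thesis
      by auto
  qed
  let ?F = "{f \<in> topspace (arr G). tgt G f \<in> {b}}"
  have "compactin (arr G) ?F"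
    using G(3)[unfolded proper_target_def, rule_format, of "{b}"] b by simp
  then have "compactin (obj G) (src G ` ?F)"
    using continuous_src by (rule image_compactin)
  moreover have "src G ` ?F = topspace (obj G)"
    using conn by (auto simp: image_iff)
  ultimately have "compactin (obj G) (topspace (obj G))"
    by simp
  then have "compactin (arr G) {g \<in> topspace (arr G). tgt G g \<in> topspace (obj G)}"
    using G(3) unfolding proper_target_def by blast
  moreover have "{g \<in> topspace (arr G). tgt G g \<in> topspace (obj G)} = topspace (arr G)"
    by auto
  ultimately have "compact_space (arr G)"
    by (simp add: compact_space_def)
  then show ?thesis
    using b conn by unfold_locales
qed

section \<open>The isotropy group as a groupoid with one object\<close>

context compact_transitive_groupoid
begin

lemma closedin_isotropy: "closedin (arr G) (isotropy G b)"
proof -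
  have "isotropy G b = {g \<in> topspace (arr G). src G g \<in> {b}} \<inter> {g \<in> topspace (arr G). tgt G g \<in> {b}}"
    by (auto simp: isotropy_def)
  then show ?thesis
    using closedin_continuous_map_preimage[OF continuous_src closedin_obj_b]
      closedin_continuous_map_preimage[OF continuous_tgt closedin_obj_b] by (simp only: closedin_Int)
qed

lemma isotropy_groupoid_simps [simp]:
  "obj (isotropy_groupoid G b) = subtopology (obj G) {b}"
  "arr (isotropy_groupoid G b) = subtopology (arr G) (isotropy G b)"
  "idt (isotropy_groupoid G b) = idt G" "src (isotropy_groupoid G b) = src G"
  "tgt (isotropy_groupoid G b) = tgt G" "ginv (isotropy_groupoid G b) = ginv G"
  "gcomp (isotropy_groupoid G b) = gcomp G"
  by (simp_all add: isotropy_groupoid_def)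

lemma topspace_arr_isotropy [simp]:
  "topspace (subtopology (arr G) (isotropy G b)) = isotropy G b"
  by (auto simp: isotropy_def)

lemma topspace_obj_b [simp]: "topspace (subtopology (obj G) {b}) = {b}"
  by auto

lemma cg_space_closed_subtopology:
  assumes "cg_space T" "closedin T C"
  shows "cg_space (subtopology T C)"
  using assms by (simp add: cg_space_def Hausdorff_space_subtopology k_space_closed_subtopology)

lemma topological_groupoid_isotropy: "topological_groupoid (isotropy_groupoid G b)"
proof
  let ?I = "isotropy_groupoid G b"
  show "cg_space (obj ?I)" "cg_space (arr ?I)"
    using cg_obj cg_arr closedin_obj_b closedin_isotropy by (simp_all add: cg_space_closed_subtopology)
  show "continuous_map (obj ?I) (arr ?I) (idt ?I)"
    using continuous_idt
    by (auto simp: continuous_map_in_subtopology continuous_map_from_subtopology isotropy_def)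
  show "continuous_map (arr ?I) (obj ?I) (src ?I)" "continuous_map (arr ?I) (obj ?I) (tgt ?I)"
    using continuous_src continuous_tgt
    by (auto simp: continuous_map_in_subtopology continuous_map_from_subtopology isotropy_def)
  show "continuous_map (arr ?I) (arr ?I) (ginv ?I)"
    using continuous_ginv
    by (auto simp: continuous_map_in_subtopology continuous_map_from_subtopology isotropy_def)
  show "continuous_map (cg_fibre_prod (arr ?I) (arr ?I) (src ?I) (tgt ?I)) (arr ?I)
      (\<lambda>(g, h). gcomp ?I g h)"
    unfolding isotropy_groupoid_simps
    by (rule continuous_map_cg_fibre_prod_subtopology[OF continuous_gcomp]) (auto simp: isotropy_def)
  show "gcomp ?I (idt ?I (tgt ?I g)) g = g" if "g \<in> topspace (arr ?I)" for g
    using that idt_gcomp[of g] by (simp add: isotropy_def)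
  show "open_map (arr ?I) (obj ?I) (src ?I)"
    unfolding open_map_def
  proof (intro allI impI)
    fix U assume "openin (arr ?I) U"
    then have "U \<subseteq> isotropy G b"
      using openin_subset by fastforce
    \<comment> \<open>The object space is a point, so every image is empty or everything.\<close>
    then have "src G ` U = {} \<or> src G ` U = topspace (obj ?I)"
      by (auto simp: isotropy_def)
    then show "openin (obj ?I) (src ?I ` U)"
      by (metis openin_empty openin_topspace isotropy_groupoid_simps(4))
  qed
qed (auto simp: isotropy_def gcomp_idt gcomp_ginv ginv_gcomp gcomp_assoc)

lemma compact_transitive_groupoid_isotropy:
  "compact_transitive_groupoid (isotropy_groupoid G b) b"
proof -
  interpret I: topological_groupoid "isotropy_groupoid G b"
    by (rule topological_groupoid_isotropy)
  show ?thesis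
  proof
    show "compact_space (arr (isotropy_groupoid G b))"
      using compact_arr closedin_isotropy by (simp add: closedin_compact_space compact_space_subtopology)
    have "idt G b \<in> isotropy G b"
      by (simp add: isotropy_def)
    then show "\<exists>f \<in> topspace (arr (isotropy_groupoid G b)).
        tgt (isotropy_groupoid G b) f = b \<and> src (isotropy_groupoid G b) f = x"
      if "x \<in> topspace (obj (isotropy_groupoid G b))" for x
      using that by (intro bexI[of _ "idt G b"]) auto
  qed simp
qed

lemma isotropy_isotropy_groupoid: "isotropy (isotropy_groupoid G b) b = isotropy G b"
  unfolding isotropy_def[of "isotropy_groupoid G b"]
  by (simp only: isotropy_groupoid_simps topspace_arr_isotropy) (auto simp: isotropy_def)

lemma closed_isotropy_subgroup_isotropy_groupoid:
  "closed_isotropy_subgroup (isotropy_groupoid G b) b H \<longleftrightarrow> closed_isotropy_subgroup G b H"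
  by (simp add: closed_isotropy_subgroup_def isotropy_isotropy_groupoid isotropy_group_def
      subtopology_subtopology)

lemma gs_fibre_simps [simp]:
  "pts (gs_fibre X b) = subtopology (pts X) {x \<in> topspace (pts X). anchor X x = b}"
  "anchor (gs_fibre X b) = anchor X" "act (gs_fibre X b) = act X"
  by (simp_all add: gs_fibre_def gs_sub_def)

lemma topspace_fibre [simp]:
  "topspace (subtopology T {x \<in> topspace T. P x}) = {x \<in> topspace T. P x}"
  by auto

section \<open>Filtrations of a G-space and of its fibre over \<open>b\<close>\<close>

context
  fixes X :: "('o, 'a, 'x) gspace_data"
  assumes X: "right_gspace G X"
begin

interpretation X: right_gspace G X by (rule X)

lemma act_X: "gspace_action G X"
  using X by (rule right_gspace_imp_gspace_action)

lemma closedin_fibre: "closedin (pts X) {x \<in> topspace (pts X). anchor X x = b}"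
  using closedin_continuous_map_preimage[OF X.continuous_anchor closedin_obj_b] by simp

lemma right_gspace_fibre: "right_gspace (isotropy_groupoid G b) (gs_fibre X b)"
proof
  let ?I = "isotropy_groupoid G b" and ?X = "gs_fibre X b"
  show "cg_space (pts ?X)"
    using X.cg_pts closedin_fibre by (simp add: cg_space_closed_subtopology)
  show "continuous_map (pts ?X) (obj ?I) (anchor ?X)"
    using X.continuous_anchor
    by (auto simp: continuous_map_in_subtopology continuous_map_from_subtopology)
  show "continuous_map (cg_fibre_prod (pts ?X) (arr ?I) (anchor ?X) (tgt ?I)) (pts ?X)
      (\<lambda>(x, g). act ?X x g)"
    unfolding isotropy_groupoid_simps gs_fibre_simps
    by (rule continuous_map_cg_fibre_prod_subtopology[OF X.continuous_act])
      (auto simp: isotropy_def X.anchor_act gspace_action.act_in_pts[OF act_X])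
qed (auto simp: isotropy_def X.anchor_act X.act_idt X.act_act)

text \<open>The anchor condition already places the values in the fibre, so shrinking the codomain
  changes nothing.\<close>

lemma fixed_map_fibre:
  "fixed_map (isotropy_groupoid G b) b H K (gs_fibre X b) c \<longleftrightarrow> fixed_map G b H K X c"
  unfolding fixed_map_def gs_fibre_simps continuous_map_in_subtopology
  using continuous_map_funspace[of K "pts X" c] by auto

text \<open>Every clause tests only points over \<open>b\<close>: the values of the maps
  \<open>c\<close>, their loop translates, and points \<open>y\<close> explicitly anchored at
  \<open>b\<close>.\<close>

lemma isotropy_cells_fibre:
  assumes S: "S \<subseteq> topspace K"
    and B: "B' = {x \<in> B. anchor X x = b}" and Y: "Y' = {x \<in> Y. anchor X x = b}"
  shows "isotropy_cells (isotropy_groupoid G b) b K S (gs_fibre X b) B' Y' \<longleftrightarrow>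
    isotropy_cells G b K S X B Y"
proof -
  have cells: "c ` S \<subseteq> B' \<longleftrightarrow> c ` S \<subseteq> B"
    "c ` (topspace K - S) \<subseteq> Y' - B' \<longleftrightarrow> c ` (topspace K - S) \<subseteq> Y - B"
    if "fixed_map G b H K X c" for H c
    using fixed_mapD(2)[OF that] S unfolding B Y by blast+
  have 1: "(closed_isotropy_subgroup G b H \<and> fixed_map G b H K X c \<and>
      c ` S \<subseteq> B' \<and> c ` (topspace K - S) \<subseteq> Y' - B') \<longleftrightarrow>
    (closed_isotropy_subgroup G b H \<and> fixed_map G b H K X c \<and>
      c ` S \<subseteq> B \<and> c ` (topspace K - S) \<subseteq> Y - B)" for H c
    using cells[of H c] by metis
  have 2: "(\<forall>y \<in> Y' - B'. anchor X y = b \<longrightarrow> P y) \<longleftrightarrow>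
      (\<forall>y \<in> Y - B. anchor X y = b \<longrightarrow> P y)" for P
    unfolding B Y by blast
  show ?thesis
    unfolding isotropy_cells_def closed_isotropy_subgroup_isotropy_groupoid fixed_map_fibre
      isotropy_isotropy_groupoid gs_fibre_simps 1 2 ..
qed

lemma invariant_subset_fibre_iff:
  "invariant_subset (isotropy_groupoid G b) (gs_fibre X b) A \<longleftrightarrow>
    A \<subseteq> {x \<in> topspace (pts X). anchor X x = b} \<and> (\<forall>x\<in>A. \<forall>g\<in>isotropy G b. act X x g \<in> A)"
  unfolding invariant_subset_def isotropy_groupoid_simps gs_fibre_simps topspace_arr_isotropy
    topspace_fibre using isotropyD(3) by blast

text \<open>For the colimit topology, the trace of a skeleton on the closed fibre is compact, hence
  closed in \<open>X\<close>. A subset of the fibre with closed traces there therefore has closed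
  traces on the skeleta of \<open>X\<close>.\<close>

lemma cell_filtration_fibre:
  assumes Sk: "cell_filtration G b X Sk"
  shows "cell_filtration (isotropy_groupoid G b) b (gs_fibre X b) (\<lambda>n. {x \<in> Sk n. anchor X x = b})"
proof -
  let ?Xb = "{x \<in> topspace (pts X). anchor X x = b}"
  let ?Sk = "\<lambda>n. {x \<in> Sk n. anchor X x = b}"
  have inv: "invariant_subset G X (Sk n)" and mono: "Sk n \<subseteq> Sk (Suc n)"
    and Un: "(\<Union>n. Sk n) = topspace (pts X)" for n
    using Sk unfolding cell_filtration_def by blast+
  have colim: "closedin (pts X) C"
    if "C \<subseteq> topspace (pts X)" "\<And>n. closedin (subtopology (pts X) (Sk n)) (C \<inter> Sk n)" for C
    using Sk that unfolding cell_filtration_def by blast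
  have SkX: "Sk n \<subseteq> topspace (pts X)" for n
    using Un by blast
  have "invariant_subset (isotropy_groupoid G b) (gs_fibre X b) (?Sk n)" for n
    unfolding invariant_subset_fibre_iff
    using inv[of n] by (auto simp: invariant_subset_def isotropy_def X.anchor_act subset_iff)
  moreover have "closedin (pts (gs_fibre X b)) C"
    if C: "C \<subseteq> ?Xb" and closed: "\<And>n. closedin (subtopology (pts (gs_fibre X b)) (?Sk n)) (C \<inter> ?Sk n)" for C
  proof -
    have "closedin (subtopology (pts X) (Sk n)) (C \<inter> Sk n)" for n
    proof -
      have eq: "?Sk n = Sk n \<inter> ?Xb" "C \<inter> ?Sk n = C \<inter> Sk n" "?Xb \<inter> ?Sk n = ?Sk n"
        using SkX[of n] C by auto
      have "compactin (pts X) (Sk n \<inter> ?Xb)"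
        using compactin_cell_filtration[OF X Sk] closedin_fibre by (rule compact_Int_closedin)
      then have "closedin (pts X) (?Sk n)"
        using X.cg_pts unfolding cg_space_def by (metis eq(1) compactin_imp_closedin)
      moreover have "closedin (subtopology (pts X) (?Sk n)) (C \<inter> Sk n)"
        using closed[of n] unfolding gs_fibre_simps subtopology_subtopology eq(2,3) .
      ultimately have "closedin (pts X) (C \<inter> Sk n)"
        by (metis closedin_trans_full)
      then show ?thesis
        by (rule closedin_subset_topspace) simp
    qed
    then have "closedin (pts X) C"
      using C by (intro colim) auto
    then show ?thesis
      using C by (simp add: closedin_subset_topspace)
  qed
  moreover have "isotropy_cells (isotropy_groupoid G b) b (ndisc 0) {} (gs_fibre X b) {} (?Sk 0)"
    using Sk isotropy_cells_fibre[of "{}" "ndisc 0" "{}" "{}" "?Sk 0" "Sk 0"]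
    by (simp add: cell_filtration_def)
  moreover have "isotropy_cells (isotropy_groupoid G b) b (ndisc (Suc n)) (topspace (nsphere n))
      (gs_fibre X b) (?Sk n) (?Sk (Suc n))" for n
    using Sk isotropy_cells_fibre[OF topspace_nsphere_subset_ndisc[of n], of "?Sk n" "Sk n" "?Sk (Suc n)" "Sk (Suc n)"]
    by (simp add: cell_filtration_def)
  moreover have "(\<Union>n. ?Sk n) = ?Xb"
    using Un by blast
  ultimately show ?thesis
    unfolding cell_filtration_def using mono by (auto simp: subset_iff)
qed

text \<open>The set is the image under (y, f) to \<open>act X y (ginv G f)\<close> of the pairs with
  \<open>y\<close> in \<open>K\<close> and \<open>f\<close> an arrow from the anchor of
  \<open>y\<close> to \<open>b\<close>. Those pairs form a closed part of the compact product of
  \<open>K\<close> and the arrow space, as \<open>obj G\<close> is Hausdorff.\<close>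

lemma compactin_translates_fibre:
  assumes K: "compactin (pts X) K"
  shows "compactin (pts X) {x \<in> topspace (pts X). anchor X x = b \<and>
    (\<exists>f \<in> topspace (arr G). tgt G f = b \<and> act X x f \<in> K)}"
proof -
  let ?T = "prod_topology (pts X) (arr G)"
  let ?P = "{p \<in> K \<times> topspace (arr G). anchor X (fst p) = src G (snd p) \<and> tgt G (snd p) \<in> {b}}"
  let ?m = "\<lambda>(y, f). act X y (ginv G f)"
  have KX: "K \<subseteq> topspace (pts X)"
    using K by (rule compactin_subset_topspace)
  have anchor: "continuous_map ?T (obj G) (\<lambda>p. anchor X (fst p))"
    and src: "continuous_map ?T (obj G) (\<lambda>p. src G (snd p))"
    and tgt: "continuous_map ?T (obj G) (\<lambda>p. tgt G (snd p))"
    using continuous_map_compose[OF continuous_map_fst X.continuous_anchor]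
      continuous_map_compose[OF continuous_map_snd continuous_src]
      continuous_map_compose[OF continuous_map_snd continuous_tgt] by (simp_all add: o_def)
  have "closedin ?T {p \<in> topspace ?T. anchor X (fst p) = src G (snd p)}"
    using cg_obj anchor src by (intro closedin_continuous_maps_eq) (auto simp: cg_space_def)
  moreover have "closedin ?T {p \<in> topspace ?T. tgt G (snd p) \<in> {b}}"
    using tgt closedin_obj_b by (rule closedin_continuous_map_preimage)
  moreover have "compactin ?T (K \<times> topspace (arr G))"
    using K compact_arr by (simp add: compactin_Times compact_space_def)
  ultimately have "compactin ?T ((K \<times> topspace (arr G)) \<inter>
      ({p \<in> topspace ?T. anchor X (fst p) = src G (snd p)} \<inter> {p \<in> topspace ?T. tgt G (snd p) \<in> {b}}))"
    by (intro compact_Int_closedin closedin_Int)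
  moreover have "(K \<times> topspace (arr G)) \<inter>
      ({p \<in> topspace ?T. anchor X (fst p) = src G (snd p)} \<inter> {p \<in> topspace ?T. tgt G (snd p) \<in> {b}}) = ?P"
    using KX by auto
  ultimately have P: "compactin ?T ?P"
    by simp
  then have topP: "topspace (subtopology ?T ?P) = ?P" and cP: "compact_space (subtopology ?T ?P)"
    using compactin_subset_topspace[OF P] by (auto simp: compact_space_subtopology)
  have "continuous_map (subtopology ?T ?P) (cg_fibre_prod (pts X) (arr G) (anchor X) (tgt G))
      (\<lambda>p. (fst p, ginv G (snd p)))"
  proof (rule continuous_map_into_cg_fibre_prod)
    show "k_space (subtopology ?T ?P)"
      using cP by (rule compact_imp_k_space)
    show "continuous_map (subtopology ?T ?P) (pts X) fst"
      by (intro continuous_map_from_subtopology continuous_map_fst)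
    have "continuous_map ?T (arr G) (\<lambda>p. ginv G (snd p))"
      using continuous_map_compose[OF continuous_map_snd continuous_ginv] by (simp add: o_def)
    then show "continuous_map (subtopology ?T ?P) (arr G) (\<lambda>p. ginv G (snd p))"
      by (rule continuous_map_from_subtopology)
  next
    fix p assume "p \<in> topspace (subtopology ?T ?P)"
    then show "anchor X (fst p) = tgt G (ginv G (snd p))"
      unfolding topP by auto
  qed
  from continuous_map_compose[OF this X.continuous_act]
  have "continuous_map (subtopology ?T ?P) (pts X) ?m"
    by (simp add: o_def case_prod_beta')
  with cP[unfolded compact_space_def topP] have "compactin (pts X) (?m ` ?P)"
    by (rule image_compactin)
  moreover have "?m ` ?P = {x \<in> topspace (pts X). anchor X x = b \<and>
    (\<exists>f \<in> topspace (arr G). tgt G f = b \<and> act X x f \<in> K)}" (is "_ = ?K")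
  proof
    show "?m ` ?P \<subseteq> ?K"
    proof (rule image_subsetI)
      fix p assume "p \<in> ?P"
      then obtain y f where p: "p = (y, f)" "y \<in> K" "f \<in> topspace (arr G)"
        "anchor X y = src G f" "tgt G f = b"
        by auto
      then have y: "y \<in> topspace (pts X)"
        using KX by blast
      have "act X (act X y (ginv G f)) f = y"
        using act_ginv_cancel'[OF act_X y] p by simp
      then show "?m p \<in> ?K"
        using p y gspace_action.act_in_pts[OF act_X y, of "ginv G f"] X.anchor_act[OF y, of "ginv G f"]
        by auto
    qed
    show "?K \<subseteq> ?m ` ?P"
    proof
      fix x assume "x \<in> ?K"
      then obtain f where x: "x \<in> topspace (pts X)" "anchor X x = b" and f: "f \<in> topspace (arr G)"
        "tgt G f = b" "act X x f \<in> K"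
        by blast
      then have "x = ?m (act X x f, f)" "(act X x f, f) \<in> ?P"
        using act_ginv_cancel[OF act_X x(1), of f] X.anchor_act[OF x(1), of f] by auto
      then show "x \<in> ?m ` ?P"
        by (rule image_eqI)
    qed
  qed
  ultimately show ?thesis
    by simp
qed

text \<open>Saturating under arrows into \<open>b\<close> inverts intersection with the fibre, so
  the cell conditions transfer unchanged and the topology of \<open>X\<close> is the remaining
  issue.\<close>

lemma cell_filtration_of_fibre:
  assumes Sk: "cell_filtration (isotropy_groupoid G b) b (gs_fibre X b) Sk"
  shows "cell_filtration G b X
    (\<lambda>n. {y. \<exists>x \<in> Sk n. \<exists>f \<in> topspace (arr G). tgt G f = b \<and> y = act X x f})"
proof -
  let ?Xb = "{x \<in> topspace (pts X). anchor X x = b}"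
  let ?Sk = "\<lambda>n. {y. \<exists>x \<in> Sk n. \<exists>f \<in> topspace (arr G). tgt G f = b \<and> y = act X x f}"
  have inv: "invariant_subset (isotropy_groupoid G b) (gs_fibre X b) (Sk n)"
    and mono: "Sk n \<subseteq> Sk (Suc n)" and Un: "(\<Union>n. Sk n) = ?Xb" for n
    using Sk unfolding cell_filtration_def gs_fibre_simps topspace_fibre by blast+
  have colim: "closedin (pts (gs_fibre X b)) C"
    if "C \<subseteq> ?Xb" "\<And>n. closedin (subtopology (pts (gs_fibre X b)) (Sk n)) (C \<inter> Sk n)" for C
    using Sk that unfolding cell_filtration_def gs_fibre_simps topspace_fibre by blast
  have SkX: "x \<in> topspace (pts X)" "anchor X x = b" if "x \<in> Sk n" for x n
    using Un that by blast+
  have "invariant_subset G X (?Sk n)" for n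
    unfolding invariant_subset_def
  proof (intro conjI ballI impI)
    show "?Sk n \<subseteq> topspace (pts X)"
      using SkX by (auto intro: gspace_action.act_in_pts[OF act_X])
    fix y g assume "y \<in> ?Sk n" and g: "g \<in> topspace (arr G)" "anchor X y = tgt G g"
    then obtain x f where x: "x \<in> Sk n" "f \<in> topspace (arr G)" "tgt G f = b" "y = act X x f"
      by blast
    then have "src G f = tgt G g"
      using g SkX X.anchor_act[of x f] by simp
    then have "act X y g = act X x (gcomp G f g)"
      using x g SkX X.act_act[of x f g] by simp
    then show "act X y g \<in> ?Sk n"
      using x g \<open>src G f = tgt G g\<close>
      by (intro CollectI bexI[of _ x] bexI[of _ "gcomp G f g"] conjI) simp_all
  qed
  moreover have "?Sk n \<subseteq> ?Sk (Suc n)" for n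
    using mono by blast
  \<comment> \<open>An arrow joining two points over \<open>b\<close> is a loop, and
    \<open>Sk n\<close> is invariant under loops, so saturation adds nothing over
    \<open>b\<close>.\<close>
  moreover have fibre: "Sk n = {y \<in> ?Sk n. anchor X y = b}" for n
  proof
    show "Sk n \<subseteq> {y \<in> ?Sk n. anchor X y = b}"
    proof
      fix x assume x: "x \<in> Sk n"
      then have "x = act X x (idt G b)"
        using SkX[OF x] X.act_idt[of x] by simp
      then have "x \<in> ?Sk n"
        using x by (intro CollectI bexI[of _ x] bexI[of _ "idt G b"] conjI) simp_all
      then show "x \<in> {y \<in> ?Sk n. anchor X y = b}"
        using SkX[OF x] by blast
    qed
    show "{y \<in> ?Sk n. anchor X y = b} \<subseteq> Sk n"
    proof
      fix y assume "y \<in> {y \<in> ?Sk n. anchor X y = b}"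
      then obtain x f where x: "x \<in> Sk n" "f \<in> topspace (arr G)" "tgt G f = b" "y = act X x f"
        "anchor X y = b"
        by blast
      then have "f \<in> isotropy G b"
        using SkX[OF x(1)] X.anchor_act[of x f] by (simp add: isotropy_def)
      then show "y \<in> Sk n"
        using inv[of n] x unfolding invariant_subset_fibre_iff by blast
    qed
  qed
  moreover have "(\<Union>n. ?Sk n) = topspace (pts X)"
  proof
    show "(\<Union>n. ?Sk n) \<subseteq> topspace (pts X)"
      using SkX by (auto intro: gspace_action.act_in_pts[OF act_X])
    show "topspace (pts X) \<subseteq> (\<Union>n. ?Sk n)"
    proof
      fix y assume y: "y \<in> topspace (pts X)"
      obtain f where f: "f \<in> topspace (arr G)" "tgt G f = b" "src G f = anchor X y"
        using connected_to_b gspace_action.anchor_in_obj[OF act_X y] by blast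
      then have "act X y (ginv G f) \<in> ?Xb"
        using y gspace_action.act_in_pts[OF act_X y, of "ginv G f"] X.anchor_act[OF y, of "ginv G f"]
        by simp
      then obtain n where "act X y (ginv G f) \<in> Sk n"
        using Un by blast
      moreover have "y = act X (act X y (ginv G f)) f"
        using act_ginv_cancel'[OF act_X y, of f] f by simp
      ultimately show "y \<in> (\<Union>n. ?Sk n)"
        using f by blast
    qed
  qed
  moreover have "closedin (pts X) C"
    if C: "C \<subseteq> topspace (pts X)" and closed: "\<And>n. closedin (subtopology (pts X) (?Sk n)) (C \<inter> ?Sk n)" for C
  proof -
    have "closedin (subtopology (pts X) K) (K \<inter> C)" if K: "compactin (pts X) K" for K
    proof -
      let ?K = "{x \<in> topspace (pts X). anchor X x = b \<and>
        (\<exists>f \<in> topspace (arr G). tgt G f = b \<and> act X x f \<in> K)}"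
      have "compactin (pts (gs_fibre X b)) ?K"
        using compactin_translates_fibre[OF K] by (auto simp: compactin_subtopology)
      moreover have "t1_space (pts (gs_fibre X b))"
        using X.cg_pts
        by (simp add: cg_space_def Hausdorff_imp_t1_space Hausdorff_space_subtopology)
      ultimately obtain n where n: "?K \<subseteq> Sk n"
        using compactin_subset_of_colimit[of "pts (gs_fibre X b)" Sk ?K] mono Un colim by auto
      have "K \<subseteq> ?Sk n"
      proof
        fix y assume "y \<in> K"
        then have y: "y \<in> topspace (pts X)"
          using compactin_subset_topspace[OF K] by blast
        obtain f where f: "f \<in> topspace (arr G)" "tgt G f = b" "src G f = anchor X y"
          using connected_to_b gspace_action.anchor_in_obj[OF act_X y] by blast
        have eq: "act X (act X y (ginv G f)) f = y"
          using act_ginv_cancel'[OF act_X y, of f] f by simp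
        have "act X y (ginv G f) \<in> ?K"
          using y f eq \<open>y \<in> K\<close> gspace_action.act_in_pts[OF act_X y, of "ginv G f"]
            X.anchor_act[OF y, of "ginv G f"]
          by (intro CollectI conjI bexI[of _ f]) simp_all
        then have "act X y (ginv G f) \<in> Sk n"
          using n by blast
        then show "y \<in> ?Sk n"
          using f eq[symmetric] by blast
      qed
      \<comment> \<open>With \<open>K\<close> inside one stage, the trace of \<open>C\<close> on
        \<open>K\<close> is inherited from its closed trace on that stage.\<close>
      then have eq: "?Sk n \<inter> K = K" "K \<inter> C = K \<inter> (C \<inter> ?Sk n)"
        by blast+
      have "closedin (subtopology (subtopology (pts X) (?Sk n)) K) (K \<inter> (C \<inter> ?Sk n))"
        using closed[of n] by (rule closedin_subtopology_Int_closed)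
      then show ?thesis
        by (simp only: subtopology_subtopology eq(1) flip: eq(2))
    qed
    then show ?thesis
      using C X.cg_pts unfolding cg_space_def k_space by blast
  qed
  moreover have "isotropy_cells G b (ndisc 0) {} X {} (?Sk 0)"
    using Sk isotropy_cells_fibre[of "{}" "ndisc 0" "{}" "{}" "Sk 0" "?Sk 0"] fibre[of 0]
    by (simp add: cell_filtration_def)
  moreover have "isotropy_cells G b (ndisc (Suc n)) (topspace (nsphere n)) X (?Sk n) (?Sk (Suc n))" for n
    using Sk isotropy_cells_fibre[OF topspace_nsphere_subset_ndisc[of n] fibre[of n] fibre[of "Suc n"]]
    unfolding cell_filtration_def by blast
  ultimately show ?thesis
    unfolding cell_filtration_def by blast
qed

end

end

theorem proposition4p9:
  fixes G :: "('o, 'a) groupoid_data" and b :: 'o and X :: "('o, 'a, 'x) gspace_data"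
  assumes "topological_groupoid G"
    and "transitive_groupoid G"
    and "proper_target G"
    and "b \<in> topspace (obj G)"
    and "right_gspace G X"
  shows "G_CW_complex G b X \<longleftrightarrow> G_CW_complex (isotropy_groupoid G b) b (gs_fibre X b)"
proof -
  interpret compact_transitive_groupoid G b
    using assms(1-4) by (rule compact_transitive_groupoid_of_proper_target)
  interpret I: compact_transitive_groupoid "isotropy_groupoid G b" b
    by (rule compact_transitive_groupoid_isotropy)
  show ?thesis
    unfolding G_CW_complex_iff_cell_filtration[OF assms(5)]
      I.G_CW_complex_iff_cell_filtration[OF right_gspace_fibre[OF assms(5)]]
    using cell_filtration_fibre[OF assms(5)] cell_filtration_of_fibre[OF assms(5)] by blast
qed

end
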